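(* Savitskii Restriction does not preserve minimality: let $\rho$ be the irreducible complex character of degree $2$ of the symmetric group $S_4$, and let $S\cong D_8$ (dihedral of order $8$) be a Sylow $2$-subgroup of $S_4$. Then $\rho$ is minimal, but for all integers $u,v$ with $2u+8v=2$ the virtual character $u\,\rho|_{S}+v\,\rho_{\mathrm{reg},S}$ of $S$ is not minimal, where $\rho_{\mathrm{reg},S}$ is the regular character of $S$. In particular, the Savitskii Restriction of $\rho$ to $S$ is not minimal.
   Context: Let $G$ be a finite group. A virtual character of $G$ is an integer linear combination of irreducible complex characters of $G$. Define a pre-order on the set of virtual complex characters of $G$ of strictly positive degree by: $\chi\le\varphi$ if $\chi(\mathrm{id})\le\varphi(\mathrm{id})$ and, for all $g\in G$, $\varphi(g)=0$ implies $\chi(g)=0$. A virtual character $\chi$ of strictly positive degree is minimal if for every virtual character $\varphi$ of strictly positive degree, $\varphi\le\chi$ implies $\chi\le\varphi$. Savitskii Restriction: if $\chi$ is a character of $G$ of degree $r$, $p$ is a prime, $p^k$ is the highest power of $p$ dividing $|G|$, $S$ is a Sylow $p$-subgroup of $G$ and $p^l=\gcd(r,p^k)$, choose integers $u,v$ with $ur+vp^k=p^l$ and $u$ minimal positive. The Savitskii Restriction of $\chi$ to $S$ is $u\,\chi|_S+v\,\rho_{\mathrm{reg},S}$. *)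

theory Defs
  imports
    "HOL-Algebra.Sym_Groups"
    "HOL-Computational_Algebra.Primes"
    "Jordan_Normal_Form.VS_Connect"
begin

definition mat_rep :: "('a, 'b) monoid_scheme \<Rightarrow> nat \<Rightarrow> ('a \<Rightarrow> complex mat) \<Rightarrow> bool" where
  "mat_rep G n R \<longleftrightarrow>
     (\<forall>g\<in>carrier G. R g \<in> carrier_mat n n) \<and>
     R \<one>\<^bsub>G\<^esub> = 1\<^sub>m n \<and>
     (\<forall>g\<in>carrier G. \<forall>h\<in>carrier G. R (g \<otimes>\<^bsub>G\<^esub> h) = R g * R h)"

definition invariant_subspace ::
    "('a, 'b) monoid_scheme \<Rightarrow> nat \<Rightarrow> ('a \<Rightarrow> complex mat) \<Rightarrow> complex vec set \<Rightarrow> bool" where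
  "invariant_subspace G n R W \<longleftrightarrow>
     VectorSpace.subspace class_ring W (module_vec TYPE(complex) n) \<and>
     (\<forall>g\<in>carrier G. \<forall>w\<in>W. R g *\<^sub>v w \<in> W)"

definition irreducible_rep :: "('a, 'b) monoid_scheme \<Rightarrow> nat \<Rightarrow> ('a \<Rightarrow> complex mat) \<Rightarrow> bool" where
  "irreducible_rep G n R \<longleftrightarrow>
     mat_rep G n R \<and> 0 < n \<and>
     (\<forall>W. invariant_subspace G n R W \<longrightarrow> W = {0\<^sub>v n} \<or> W = carrier_vec n)"

definition mat_trace :: "complex mat \<Rightarrow> complex" where
  "mat_trace A = (\<Sum>i<dim_row A. A $$ (i, i))"

text \<open>
  A function on a group is represented by its extension by zero outside the carrier, so that
  equality of characters is equality of HOL functions.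
\<close>

definition restrict_fun :: "'a set \<Rightarrow> ('a \<Rightarrow> complex) \<Rightarrow> 'a \<Rightarrow> complex" where
  "restrict_fun S \<chi> = (\<lambda>g. if g \<in> S then \<chi> g else 0)"

definition rep_character :: "('a, 'b) monoid_scheme \<Rightarrow> ('a \<Rightarrow> complex mat) \<Rightarrow> 'a \<Rightarrow> complex" where
  "rep_character G R = restrict_fun (carrier G) (\<lambda>g. mat_trace (R g))"

definition irreducible_characters :: "('a, 'b) monoid_scheme \<Rightarrow> ('a \<Rightarrow> complex) set" where
  "irreducible_characters G = {rep_character G R | n R. irreducible_rep G n R}"

definition virtual_characters :: "('a, 'b) monoid_scheme \<Rightarrow> ('a \<Rightarrow> complex) set" where
  "virtual_characters G =
     {(\<lambda>g. \<Sum>\<psi>\<in>A. of_int (c \<psi>) * \<psi> g) | A (c :: ('a \<Rightarrow> complex) \<Rightarrow> int).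
        finite A \<and> A \<subseteq> irreducible_characters G}"

text \<open>
  The value of a virtual character at the identity is an integer; the floor only turns that
  complex number into an element of type \<^typ>\<open>int\<close>.
\<close>

definition char_degree :: "('a, 'b) monoid_scheme \<Rightarrow> ('a \<Rightarrow> complex) \<Rightarrow> int" where
  "char_degree G \<chi> = \<lfloor>Re (\<chi> \<one>\<^bsub>G\<^esub>)\<rfloor>"

text \<open>
  The trace of left translation by \<open>g\<close> on the group algebra, in the basis \<^term>\<open>carrier G\<close>.
\<close>

definition regular_character :: "('a, 'b) monoid_scheme \<Rightarrow> 'a \<Rightarrow> complex" where
  "regular_character G =
     restrict_fun (carrier G) (\<lambda>g. \<Sum>x\<in>carrier G. if g \<otimes>\<^bsub>G\<^esub> x = x then 1 else 0)"

definition pos_virtual_characters :: "('a, 'b) monoid_scheme \<Rightarrow> ('a \<Rightarrow> complex) set" where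
  "pos_virtual_characters G = {\<chi> \<in> virtual_characters G. 0 < char_degree G \<chi>}"

definition vchar_le :: "('a, 'b) monoid_scheme \<Rightarrow> ('a \<Rightarrow> complex) \<Rightarrow> ('a \<Rightarrow> complex) \<Rightarrow> bool" where
  "vchar_le G \<chi> \<phi> \<longleftrightarrow>
     char_degree G \<chi> \<le> char_degree G \<phi> \<and> (\<forall>g\<in>carrier G. \<phi> g = 0 \<longrightarrow> \<chi> g = 0)"

definition minimal_vchar :: "('a, 'b) monoid_scheme \<Rightarrow> ('a \<Rightarrow> complex) \<Rightarrow> bool" where
  "minimal_vchar G \<chi> \<longleftrightarrow>
     \<chi> \<in> pos_virtual_characters G \<and>
     (\<forall>\<phi>\<in>pos_virtual_characters G. vchar_le G \<phi> \<chi> \<longrightarrow> vchar_le G \<chi> \<phi>)"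

definition sylow_subgroup :: "('a, 'b) monoid_scheme \<Rightarrow> nat \<Rightarrow> 'a set \<Rightarrow> bool" where
  "sylow_subgroup G p S \<longleftrightarrow>
     prime p \<and> subgroup S G \<and> card S = p ^ multiplicity p (Coset.order G)"

definition virtual_combination ::
    "('a, 'b) monoid_scheme \<Rightarrow> 'a set \<Rightarrow> ('a \<Rightarrow> complex) \<Rightarrow> int \<Rightarrow> int \<Rightarrow> 'a \<Rightarrow> complex" where
  "virtual_combination G S \<chi> u v =
     (\<lambda>g. of_int u * restrict_fun S \<chi> g + of_int v * regular_character (G\<lparr>carrier := S\<rparr>) g)"

text \<open>
  For \<open>r > 0\<close> and \<open>q > 0\<close> the least positive \<open>u\<close> exists by Bezout, and it determines \<open>v\<close>
  because \<open>q \<noteq> 0\<close>.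
\<close>

definition savitskii_u :: "int \<Rightarrow> int \<Rightarrow> int" where
  "savitskii_u r q = (LEAST u. 0 < u \<and> (\<exists>v. u * r + v * q = gcd r q))"

definition savitskii_v :: "int \<Rightarrow> int \<Rightarrow> int" where
  "savitskii_v r q = (THE v. savitskii_u r q * r + v * q = gcd r q)"

definition savitskii_restriction ::
    "('a, 'b) monoid_scheme \<Rightarrow> nat \<Rightarrow> 'a set \<Rightarrow> ('a \<Rightarrow> complex) \<Rightarrow> 'a \<Rightarrow> complex" where
  "savitskii_restriction G p S \<chi> =
     (let r = char_degree G \<chi>; q = int (p ^ multiplicity p (Coset.order G))
      in virtual_combination G S \<chi> (savitskii_u r q) (savitskii_v r q))"

text \<open>
  The dihedral group of order \<open>2 * n\<close>: the pair \<open>(i, s)\<close> stands for the rotation \<open>r ^ i\<close>,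
  followed on the right by the reflection if \<open>s\<close> holds.
\<close>

definition dihedral_group :: "nat \<Rightarrow> (int \<times> bool) monoid" where
  "dihedral_group n =
     \<lparr>carrier = {0..<int n} \<times> UNIV,
      mult = (\<lambda>(i, s) (j, t). ((if s then i - j else i + j) mod int n, s \<noteq> t)),
      one = (0, False)\<rparr>"

end

theory Submission
  imports Defs "Jordan_Normal_Form.Schur_Decomposition" "HOL-Algebra.Multiplicative_Group"
begin

text \<open>
  The character \<open>\<rho>\<close> of degree two of the symmetric group on four points is \<open>2\<close> on the normal
  Klein four-group, \<open>- 1\<close> on the 3-cycles and \<open>0\<close> on the odd permutations. The reason for the
  failure is that a Sylow 2-subgroup \<open>S\<close> has a character with more zeros. On \<open>S\<close>, which consists
  of the four-group and four odd permutations, any combination \<open>u \<rho> + v reg\<close> of degree two is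
  nonzero on the whole four-group, since \<open>u = 1 - 4 v\<close> cannot vanish. The faithful irreducible
  character of degree two of the dihedral group vanishes outside the centre, hence also at two
  elements of the four-group, and so lies strictly below
  (\<open>dihedral_8_virtual_combination\<close>).

  On the whole group this room does not exist. The averaging projection of a subgroup has
  integral trace, so the sum of a virtual character over a subgroup is divisible by the order of
  the subgroup (\<open>sum_virtual_character_subgroup\<close>). Since the three nonidentity elements of the
  four-group, and likewise all 3-cycles, are conjugate, this rules out every competitor with
  smaller degree or with further zeros (\<open>standard_character_minimal\<close>).

  The same averaging argument replaces the orthogonality relations in the proof that \<open>\<rho>\<close> is the
  only irreducible character of degree two (\<open>irreducible_degree_2_character\<close>): a normal subgroup
  over which an irreducible character has nonzero sum acts trivially
  (\<open>irreducible_rep_trivial_on_normal\<close>). Existence comes from the conjugation action on the three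
  nonidentity elements of the four-group. Finally, every subgroup of order eight contains the
  four-group and a 4-cycle, which gives the isomorphism with the dihedral group
  (\<open>sylow_2_iso_dihedral\<close>). Facts about individual permutations are finite computations in
  one-line notation.
\<close>

section \<open>Traces of group averages\<close>

lemma mat_trace_comm:
  assumes "A \<in> carrier_mat n n" "B \<in> carrier_mat n n"
  shows "mat_trace (A * B) = mat_trace (B * A)"
proof -
  have "mat_trace (A * B) = (\<Sum>i<n. \<Sum>k<n. A $$ (i, k) * B $$ (k, i))"
    using assms by (auto simp: mat_trace_def scalar_prod_def atLeast0LessThan intro!: sum.cong)
  also have "\<dots> = (\<Sum>k<n. \<Sum>i<n. B $$ (k, i) * A $$ (i, k))"
    by (subst sum.swap) (simp add: mult.commute)
  also have "\<dots> = mat_trace (B * A)"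
    using assms by (auto simp: mat_trace_def scalar_prod_def atLeast0LessThan intro!: sum.cong)
  finally show ?thesis .
qed

text \<open>
  An idempotent complex matrix is similar to an upper triangular one, which is again idempotent;
  its diagonal entries are then idempotent scalars, and the trace counts those equal to \<open>1\<close>.
\<close>

lemma idempotent_mat_trace_Nats:
  assumes P: "P \<in> carrier_mat n n" and idem: "P * P = P"
  shows "mat_trace P \<in> \<nat>"
proof -
  obtain es where "char_poly P = (\<Prod>a\<leftarrow>es. [:- a, 1:])"
    using char_poly_factorized[OF P] by blast
  then obtain B where B: "B \<in> carrier_mat n n" "upper_triangular B" "similar_mat P B"
    using schur_decomposition_exists[OF P] by blast
  then obtain C D where wit: "similar_mat_wit P B C D"
    unfolding similar_mat_def by blast
  note w = similar_mat_witD2[OF P wit]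
  have BD: "B = D * P * C"
    using similar_mat_witD2(3)[OF B(1) similar_mat_wit_sym[OF wit]] .
  have "B * B = D * P * (C * D) * (P * C)"
    unfolding BD using w P by (simp add: assoc_mult_mat[of _ n n _ n _ n])
  also have "\<dots> = D * (P * P) * C"
    using w P by (simp add: assoc_mult_mat[of _ n n _ n _ n])
  also have "\<dots> = B"
    using idem BD by simp
  finally have BB: "B * B = B" .
  have diag: "B $$ (i, i) \<in> \<nat>" if i: "i < n" for i
  proof -
    have "B $$ (i, i) = (\<Sum>k<n. B $$ (i, k) * B $$ (k, i))"
      using i B(1) by (subst BB[symmetric]) (simp add: scalar_prod_def atLeast0LessThan)
    also have "\<dots> = (\<Sum>k<n. if k = i then B $$ (i, i) * B $$ (i, i) else 0)"
    proof (rule sum.cong[OF refl])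
      fix k assume "k \<in> {..<n}"
      then show "B $$ (i, k) * B $$ (k, i) = (if k = i then B $$ (i, i) * B $$ (i, i) else 0)"
        using B i upper_triangularD[OF B(2), of k i] upper_triangularD[OF B(2), of i k]
        by (cases k i rule: linorder_cases) auto
    qed
    also have "\<dots> = B $$ (i, i) * B $$ (i, i)"
      using i by simp
    finally have "B $$ (i, i) = 0 \<or> B $$ (i, i) = 1"
      by auto
    then show ?thesis by auto
  qed
  have "mat_trace P = mat_trace (C * (B * D))"
    using w by (simp add: assoc_mult_mat[of _ n n _ n _ n])
  also have "\<dots> = mat_trace (B * D * C)"
    using w by (intro mat_trace_comm[of _ n]) auto
  also have "\<dots> = mat_trace B"
    using w by (simp add: assoc_mult_mat[of _ n n _ n _ n])
  also have "\<dots> \<in> \<nat>"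
  proof -
    have "(\<Sum>i\<in>I. B $$ (i, i)) \<in> \<nat>" if "I \<subseteq> {..<n}" for I
      using that by (induction I rule: infinite_finite_induct) (auto simp: diag)
    then show ?thesis using B(1) by (simp add: mat_trace_def)
  qed
  finally show ?thesis .
qed

text \<open>
  The projection onto the vectors fixed by \<open>H\<close>, written entrywise because matrices of varying
  size do not form a monoid type over which one could sum.
\<close>

definition mat_average :: "nat \<Rightarrow> 'a set \<Rightarrow> ('a \<Rightarrow> complex mat) \<Rightarrow> complex mat" where
  "mat_average n H R = mat n n (\<lambda>(i, j). (\<Sum>h\<in>H. R h $$ (i, j)) / of_nat (card H))"

lemma mat_average_carrier [simp]: "mat_average n H R \<in> carrier_mat n n"
  by (simp add: mat_average_def)

lemma mat_repD:
  assumes "mat_rep G n R" "g \<in> carrier G"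
  shows "R g \<in> carrier_mat n n" "dim_row (R g) = n" "dim_col (R g) = n"
  using assms by (auto simp: mat_rep_def)

lemma mat_rep_mult:
  assumes "mat_rep G n R" "g \<in> carrier G" "h \<in> carrier G"
  shows "R (g \<otimes>\<^bsub>G\<^esub> h) = R g * R h"
  using assms by (auto simp: mat_rep_def)

lemma (in group) bij_betw_mult_left_subgroup:
  assumes "subgroup H G" "h \<in> H"
  shows "bij_betw (\<lambda>x. h \<otimes> x) H H"
proof -
  interpret H: subgroup H G by fact
  show ?thesis
    by (rule bij_betw_byWitness[where f' = "\<lambda>x. inv h \<otimes> x"])
       (use assms(2) H.subset in \<open>auto simp: m_assoc[symmetric]\<close>)
qed

lemma mat_average_trace:
  assumes R: "mat_rep G n R" and H: "H \<subseteq> carrier G"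
  shows "mat_trace (mat_average n H R) = (\<Sum>h\<in>H. mat_trace (R h)) / of_nat (card H)"
proof -
  have "(\<Sum>h\<in>H. mat_trace (R h)) = (\<Sum>h\<in>H. \<Sum>i<n. R h $$ (i, i))"
    using mat_repD(2)[OF R] H by (auto simp: mat_trace_def intro!: sum.cong)
  also have "\<dots> = (\<Sum>i<n. \<Sum>h\<in>H. R h $$ (i, i))"
    by (rule sum.swap)
  finally show ?thesis
    by (simp add: mat_trace_def mat_average_def sum_divide_distrib)
qed

lemma (in group) mult_mat_average:
  assumes R: "mat_rep G n R" and H: "subgroup H G" and h: "h \<in> H"
  shows "R h * mat_average n H R = mat_average n H R"
proof (rule eq_matI)
  have HG: "x \<in> carrier G" if "x \<in> H" for x
    using that H by (rule subgroup.mem_carrier[rotated])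
  fix i j assume "i < dim_row (mat_average n H R)" "j < dim_col (mat_average n H R)"
  then have ij: "i < n" "j < n" by (auto simp: mat_average_def)
  have "(\<Sum>x\<in>H. R x $$ (i, j)) = (\<Sum>x\<in>H. R (h \<otimes> x) $$ (i, j))"
    using sum.reindex_bij_betw[OF bij_betw_mult_left_subgroup[OF H h], of "\<lambda>x. R x $$ (i, j)"] by simp
  also have "\<dots> = (\<Sum>x\<in>H. \<Sum>k<n. R h $$ (i, k) * R x $$ (k, j))"
  proof (rule sum.cong[OF refl])
    fix x assume x: "x \<in> H"
    show "R (h \<otimes> x) $$ (i, j) = (\<Sum>k<n. R h $$ (i, k) * R x $$ (k, j))"
      using mat_rep_mult[OF R HG[OF h] HG[OF x]] mat_repD[OF R HG[OF h]] mat_repD[OF R HG[OF x]] ij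
      by (simp add: scalar_prod_def atLeast0LessThan)
  qed
  also have "\<dots> = (\<Sum>k<n. R h $$ (i, k) * (\<Sum>x\<in>H. R x $$ (k, j)))"
    by (subst sum.swap) (simp add: sum_distrib_left)
  finally have eq: "(\<Sum>x\<in>H. R x $$ (i, j)) = (\<Sum>k<n. R h $$ (i, k) * (\<Sum>x\<in>H. R x $$ (k, j)))" .
  show "(R h * mat_average n H R) $$ (i, j) = mat_average n H R $$ (i, j)"
    using ij mat_repD[OF R HG[OF h]]
    by (simp add: mat_average_def scalar_prod_def atLeast0LessThan eq) (subst sum_divide_distrib, simp)
qed (use mat_repD[OF R, of h] subgroup.mem_carrier[OF H h] in \<open>auto simp: mat_average_def\<close>)

lemma (in group) mat_average_idempotent:
  assumes R: "mat_rep G n R" and H: "subgroup H G" and fin: "finite H"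
  shows "mat_average n H R * mat_average n H R = mat_average n H R"
proof (rule eq_matI)
  let ?P = "mat_average n H R"
  have HG: "x \<in> carrier G" if "x \<in> H" for x
    using that H by (rule subgroup.mem_carrier[rotated])
  have card: "card H \<noteq> 0"
    using fin subgroup.one_closed[OF H] by auto
  fix i j assume "i < dim_row ?P" "j < dim_col ?P"
  then have ij: "i < n" "j < n" by (auto simp: mat_average_def)
  have "(?P * ?P) $$ (i, j) = (\<Sum>k<n. (\<Sum>h\<in>H. R h $$ (i, k)) / of_nat (card H) * ?P $$ (k, j))"
    using ij by (simp add: mat_average_def scalar_prod_def atLeast0LessThan)
  also have "\<dots> = (\<Sum>k<n. \<Sum>h\<in>H. R h $$ (i, k) * ?P $$ (k, j)) / of_nat (card H)"
    by (simp add: sum_divide_distrib sum_distrib_right)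
  also have "\<dots> = (\<Sum>h\<in>H. \<Sum>k<n. R h $$ (i, k) * ?P $$ (k, j)) / of_nat (card H)"
    by (subst sum.swap) simp
  also have "(\<Sum>h\<in>H. \<Sum>k<n. R h $$ (i, k) * ?P $$ (k, j)) = (\<Sum>h\<in>H. ?P $$ (i, j))"
  proof (rule sum.cong[OF refl])
    fix h assume h: "h \<in> H"
    have "(R h * ?P) $$ (i, j) = (\<Sum>k<n. R h $$ (i, k) * ?P $$ (k, j))"
      using ij mat_repD[OF R HG[OF h]] by (simp add: mat_average_def scalar_prod_def atLeast0LessThan)
    then show "(\<Sum>k<n. R h $$ (i, k) * ?P $$ (k, j)) = ?P $$ (i, j)"
      using mult_mat_average[OF R H h] by simp
  qed
  finally show "(?P * ?P) $$ (i, j) = ?P $$ (i, j)"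
    using card by simp
qed (auto simp: mat_average_def)

text \<open>
  The multiplicity of the trivial character in the restriction to \<open>H\<close> is the trace of the
  averaging projection. This is the only integrality fact about characters in the proof: all
  congruences between character values come from it, with \<open>H\<close> of order 1, 2, 3 or 4.
\<close>

lemma (in group) sum_mat_trace_subgroup:
  assumes R: "mat_rep G n R" and H: "subgroup H G" and fin: "finite H"
  shows "\<exists>m::nat. (\<Sum>h\<in>H. mat_trace (R h)) = of_nat (card H) * of_nat m"
proof -
  have "mat_trace (mat_average n H R) \<in> \<nat>"
    by (rule idempotent_mat_trace_Nats[OF mat_average_carrier mat_average_idempotent[OF R H fin]])
  then obtain m where "(\<Sum>h\<in>H. mat_trace (R h)) / of_nat (card H) = of_nat m"
    unfolding mat_average_trace[OF R subgroup.subset[OF H]] by (auto elim: Nats_cases)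
  moreover have "card H \<noteq> 0"
    using fin subgroup.one_closed[OF H] by auto
  ultimately show ?thesis
    by (intro exI[of _ m]) (simp add: field_simps)
qed

section \<open>Normal subgroups acting trivially\<close>

lemma subspace_iff:
  "VectorSpace.subspace class_ring W (module_vec TYPE(complex) n) \<longleftrightarrow>
     W \<subseteq> carrier_vec n \<and> 0\<^sub>v n \<in> W \<and> (\<forall>v\<in>W. \<forall>w\<in>W. v + w \<in> W) \<and> (\<forall>c. \<forall>v\<in>W. c \<cdot>\<^sub>v v \<in> W)"
proof -
  interpret vec_space "TYPE(complex)" n .
  have "Module.module class_ring (module_vec TYPE(complex) n)"
    using vectorspace_axioms by (rule vectorspace.axioms)
  with vectorspace_axioms show ?thesis
    by (auto simp: VectorSpace.subspace_def submodule_def module_vec_simps class_ring_simps)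
qed

lemma irreducible_repD:
  assumes "irreducible_rep G n R" "invariant_subspace G n R W"
  shows "W = {0\<^sub>v n} \<or> W = carrier_vec n"
  using assms by (simp add: irreducible_rep_def)

text \<open>
  The vectors fixed by a normal subgroup form an invariant subspace, so irreducibility leaves
  only two possibilities. If no nonzero vector is fixed, then the averaging projection vanishes,
  and so does its trace.
\<close>

lemma (in normal) irreducible_rep_trivial_on_normal:
  assumes irr: "irreducible_rep G n R" and fin: "finite H"
    and sum: "(\<Sum>h\<in>H. mat_trace (R h)) \<noteq> 0" and h: "h \<in> H"
  shows "R h = 1\<^sub>m n"
proof -
  let ?W = "{w \<in> carrier_vec n. \<forall>h\<in>H. R h *\<^sub>v w = w}"
  let ?P = "mat_average n H R"
  have R: "mat_rep G n R" using irr by (simp add: irreducible_rep_def)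
  note Rc = mat_repD(1)[OF R]
  have HG: "x \<in> carrier G" if "x \<in> H" for x
    using that by auto
  have zero_mult: "R g *\<^sub>v 0\<^sub>v n = 0\<^sub>v n" if "g \<in> carrier G" for g
    using Rc[OF that] by (auto simp: vec_eq_iff)
  have "R g *\<^sub>v w \<in> ?W" if g: "g \<in> carrier G" and w: "w \<in> ?W" for g w
  proof -
    have "R h *\<^sub>v (R g *\<^sub>v w) = R g *\<^sub>v w" if h: "h \<in> H" for h
    proof -
      have k: "inv g \<otimes> h \<otimes> g \<in> H"
        using inv_op_closed1 g h by simp
      have "h \<otimes> g = g \<otimes> (inv g \<otimes> h \<otimes> g)"
        using g HG[OF h] by (simp add: m_assoc[symmetric])
      then have "R h * R g = R g * R (inv g \<otimes> h \<otimes> g)"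
        using mat_rep_mult[OF R g HG[OF k]] mat_rep_mult[OF R HG[OF h] g] by simp
      then have "R h *\<^sub>v (R g *\<^sub>v w) = R g *\<^sub>v (R (inv g \<otimes> h \<otimes> g) *\<^sub>v w)"
        using w assoc_mult_mat_vec[OF Rc[OF g] Rc[OF HG[OF k]], of w]
          assoc_mult_mat_vec[OF Rc[OF HG[OF h]] Rc[OF g], of w] by simp
      also have "R (inv g \<otimes> h \<otimes> g) *\<^sub>v w = w"
        using w k by blast
      finally show ?thesis .
    qed
    then show ?thesis using Rc[OF g] w by auto
  qed
  then have "invariant_subspace G n R ?W"
    unfolding invariant_subspace_def subspace_iff
    by (auto simp: mult_add_distrib_mat_vec[OF Rc[OF HG]] mult_mat_vec[OF Rc[OF HG]] zero_mult[OF HG])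
  then consider "?W = {0\<^sub>v n}" | "?W = carrier_vec n"
    using irreducible_repD[OF irr] by blast
  then show ?thesis
  proof cases
    case 1
    have "col ?P j = 0\<^sub>v n" if j: "j < n" for j
    proof -
      have "R h *\<^sub>v col ?P j = col ?P j" if "h \<in> H" for h
        using mult_mat_average[OF R subgroup_axioms that] col_mult2[OF Rc[OF HG[OF that]] _ j, of ?P]
        by simp
      then have "col ?P j \<in> ?W" using col_carrier_vec[OF j mat_average_carrier] by auto
      with 1 show ?thesis by blast
    qed
    then have "mat_trace ?P = 0"
      by (auto simp: mat_trace_def mat_average_def vec_eq_iff intro!: sum.neutral)
    then show ?thesis
      using sum mat_average_trace[OF R subset] fin h by (auto simp: card_eq_0_iff)
  next
    case 2
    show ?thesis
    proof (rule eq_matI)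
      fix i j assume "i < dim_row (1\<^sub>m n :: complex mat)" "j < dim_col (1\<^sub>m n :: complex mat)"
      then have ij: "i < n" "j < n" by auto
      have "R h *\<^sub>v unit_vec n j = unit_vec n j"
        using 2 h by auto
      then have "(R h *\<^sub>v unit_vec n j) $ i = unit_vec n j $ i" by simp
      then show "R h $$ (i, j) = 1\<^sub>m n $$ (i, j)"
        using ij Rc[OF HG[OF h]] by (simp add: row_def)
    qed (use mat_repD[OF R HG[OF h]] in auto)
  qed
qed

text \<open>
  The orthogonality of a nonlinear irreducible character to the trivial character, as the case
  of the previous lemma in which the normal subgroup is the whole group: a trivial
  representation of degree at least two has a proper nonzero invariant subspace.
\<close>

lemma (in group) sum_mat_trace_irreducible:
  assumes irr: "irreducible_rep G n R" and n: "2 \<le> n" and fin: "finite (carrier G)"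
  shows "(\<Sum>g\<in>carrier G. mat_trace (R g)) = 0"
proof (rule ccontr)
  assume sum: "\<not> ?thesis"
  interpret normal "carrier G" G
    using normal_self .
  have triv: "R g = 1\<^sub>m n" if "g \<in> carrier G" for g
    using irreducible_rep_trivial_on_normal[OF irr fin _ that] sum by simp
  let ?W = "{w \<in> carrier_vec n. w $ 0 = (0 :: complex)}"
  have "invariant_subspace G n R ?W"
    using triv n unfolding invariant_subspace_def subspace_iff by auto
  then have "?W = {0\<^sub>v n} \<or> ?W = carrier_vec n"
    by (rule irreducible_repD[OF irr])
  moreover have "unit_vec n 1 \<in> ?W" "unit_vec n 1 \<noteq> (0\<^sub>v n :: complex vec)"
    using n by (auto simp: vec_eq_iff)
  moreover have "unit_vec n 0 \<notin> ?W" "unit_vec n 0 \<in> carrier_vec n"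
    using n by auto
  ultimately show False by blast
qed

lemma irreducible_rep_twist:
  assumes irr: "irreducible_rep G n R"
    and one: "\<epsilon> \<one>\<^bsub>G\<^esub> = 1" and nz: "\<And>g. g \<in> carrier G \<Longrightarrow> \<epsilon> g \<noteq> 0"
    and mult: "\<And>g h. g \<in> carrier G \<Longrightarrow> h \<in> carrier G \<Longrightarrow> \<epsilon> (g \<otimes>\<^bsub>G\<^esub> h) = \<epsilon> g * \<epsilon> h"
  shows "irreducible_rep G n (\<lambda>g. \<epsilon> g \<cdot>\<^sub>m R g)"
proof -
  have R: "mat_rep G n R" using irr by (simp add: irreducible_rep_def)
  note Rc = mat_repD(1)[OF R]
  have "mat_rep G n (\<lambda>g. \<epsilon> g \<cdot>\<^sub>m R g)"
    unfolding mat_rep_def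
  proof (intro conjI ballI)
    show "\<epsilon> \<one>\<^bsub>G\<^esub> \<cdot>\<^sub>m R \<one>\<^bsub>G\<^esub> = 1\<^sub>m n"
      using R one by (auto simp: mat_rep_def intro!: eq_matI)
    fix g h assume gh: "g \<in> carrier G" "h \<in> carrier G"
    then show "\<epsilon> (g \<otimes>\<^bsub>G\<^esub> h) \<cdot>\<^sub>m R (g \<otimes>\<^bsub>G\<^esub> h) = (\<epsilon> g \<cdot>\<^sub>m R g) * (\<epsilon> h \<cdot>\<^sub>m R h)"
      using Rc[OF gh(1)] Rc[OF gh(2)] mult[OF gh] mat_rep_mult[OF R gh]
      by (auto simp: mult_smult_assoc_mat[of _ n n _ n] mult_smult_distrib[of _ n n _ n]
          intro!: eq_matI)
  qed (use Rc in auto)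
  moreover have "invariant_subspace G n R W"
    if W: "invariant_subspace G n (\<lambda>g. \<epsilon> g \<cdot>\<^sub>m R g) W" for W
    unfolding invariant_subspace_def
  proof (intro conjI ballI)
    show sub: "VectorSpace.subspace class_ring W (module_vec TYPE(complex) n)"
      using W by (simp add: invariant_subspace_def)
    fix g w assume g: "g \<in> carrier G" and w: "w \<in> W"
    have wc: "w \<in> carrier_vec n"
      using w sub by (auto simp: subspace_iff)
    have "(1 / \<epsilon> g) \<cdot>\<^sub>v ((\<epsilon> g \<cdot>\<^sub>m R g) *\<^sub>v w) \<in> W"
      using W g w by (auto simp: invariant_subspace_def subspace_iff)
    also have "(1 / \<epsilon> g) \<cdot>\<^sub>v ((\<epsilon> g \<cdot>\<^sub>m R g) *\<^sub>v w) = R g *\<^sub>v w"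
      using nz[OF g] wc Rc[OF g]
      by (auto simp: vec_eq_iff scalar_prod_def row_def sum_distrib_left intro!: sum.cong)
    finally show "R g *\<^sub>v w \<in> W" .
  qed
  ultimately show ?thesis
    using irr by (auto simp: irreducible_rep_def)
qed

section \<open>Virtual characters\<close>

lemma mat_trace_one [simp]: "mat_trace (1\<^sub>m n) = of_nat n"
  by (simp add: mat_trace_def)

lemma char_degree_rep_character:
  assumes "group G" "mat_rep G n R"
  shows "char_degree G (rep_character G R) = int n"
proof -
  interpret group G by fact
  show ?thesis
    using assms(2) by (simp add: char_degree_def rep_character_def restrict_fun_def mat_rep_def)
qed

lemma (in group) mat_trace_conj:
  assumes R: "mat_rep G n R" and gh: "g \<in> carrier G" "h \<in> carrier G" and k: "k \<in> carrier G"
    and eq: "k \<otimes> g = h \<otimes> k"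
  shows "mat_trace (R g) = mat_trace (R h)"
proof -
  have h: "h = (k \<otimes> g) \<otimes> inv k"
    using gh k eq by (simp add: m_assoc)
  have g: "g = inv k \<otimes> (k \<otimes> g)"
    using gh k by (simp add: m_assoc[symmetric])
  have kg: "k \<otimes> g \<in> carrier G" "inv k \<in> carrier G"
    using gh k by auto
  have "mat_trace (R h) = mat_trace (R (k \<otimes> g) * R (inv k))"
    using mat_rep_mult[OF R kg] h by simp
  also have "\<dots> = mat_trace (R (inv k) * R (k \<otimes> g))"
    by (rule mat_trace_comm[OF mat_repD(1)[OF R kg(1)] mat_repD(1)[OF R kg(2)]])
  also have "\<dots> = mat_trace (R g)"
    using mat_rep_mult[OF R kg(2,1)] g by simp
  finally show ?thesis ..
qed

lemma (in group) virtual_character_conj: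
  assumes \<phi>: "\<phi> \<in> virtual_characters G" and gh: "g \<in> carrier G" "h \<in> carrier G" and k: "k \<in> carrier G"
    and eq: "k \<otimes> g = h \<otimes> k"
  shows "\<phi> g = \<phi> h"
proof -
  obtain A c where A: "A \<subseteq> irreducible_characters G"
    and \<phi>_eq: "\<phi> = (\<lambda>g. \<Sum>\<psi>\<in>A. of_int (c \<psi>) * \<psi> g)"
    using \<phi> unfolding virtual_characters_def by blast
  have "\<psi> g = \<psi> h" if in_A: "\<psi> \<in> A" for \<psi>
  proof -
    obtain n R where "\<psi> = rep_character G R" "irreducible_rep G n R"
      using in_A A unfolding irreducible_characters_def by blast
    then show ?thesis
      using mat_trace_conj[OF _ gh k eq] gh
      by (auto simp: rep_character_def restrict_fun_def irreducible_rep_def)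
  qed
  then show ?thesis unfolding \<phi>_eq by (intro sum.cong) auto
qed

lemma (in group) sum_virtual_character_subgroup:
  assumes \<phi>: "\<phi> \<in> virtual_characters G" and H: "subgroup H G" and fin: "finite H"
  shows "\<exists>m::int. (\<Sum>h\<in>H. \<phi> h) = of_nat (card H) * of_int m"
proof -
  obtain A c where A: "A \<subseteq> irreducible_characters G"
    and \<phi>_eq: "\<phi> = (\<lambda>g. \<Sum>\<psi>\<in>A. of_int (c \<psi>) * \<psi> g)"
    using \<phi> unfolding virtual_characters_def by blast
  have "\<exists>m::int. (\<Sum>h\<in>H. \<psi> h) = of_nat (card H) * of_int m" if in_A: "\<psi> \<in> A" for \<psi>
  proof -
    obtain n R where R: "\<psi> = rep_character G R" "irreducible_rep G n R"
      using in_A A unfolding irreducible_characters_def by blast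
    from R(2) have "mat_rep G n R" by (simp add: irreducible_rep_def)
    from sum_mat_trace_subgroup[OF this H fin]
    obtain m :: nat where "(\<Sum>h\<in>H. mat_trace (R h)) = of_nat (card H) * of_nat m" ..
    moreover have "(\<Sum>h\<in>H. \<psi> h) = (\<Sum>h\<in>H. mat_trace (R h))"
      using subgroup.subset[OF H] R(1)
      by (auto simp: rep_character_def restrict_fun_def intro!: sum.cong)
    ultimately show ?thesis
      by (intro exI[of _ "int m"]) simp
  qed
  then obtain m where m: "\<And>\<psi>. \<psi> \<in> A \<Longrightarrow> (\<Sum>h\<in>H. \<psi> h) = of_nat (card H) * of_int (m \<psi> :: int)"
    by metis
  have "(\<Sum>h\<in>H. \<phi> h) = (\<Sum>\<psi>\<in>A. of_int (c \<psi>) * (\<Sum>h\<in>H. \<psi> h))"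
    unfolding \<phi>_eq by (subst sum.swap) (simp add: sum_distrib_left)
  also have "\<dots> = of_nat (card H) * of_int (\<Sum>\<psi>\<in>A. c \<psi> * m \<psi>)"
    by (simp add: m sum_distrib_left mult.left_commute)
  finally show ?thesis by blast
qed

lemma (in group) virtual_character_one:
  assumes "\<phi> \<in> virtual_characters G"
  shows "\<phi> \<one> = of_int (char_degree G \<phi>)"
proof -
  obtain m :: int where "\<phi> \<one> = of_int m"
    using sum_virtual_character_subgroup[OF assms triv_subgroup] by force
  then show ?thesis by (simp add: char_degree_def)
qed

lemma irreducible_imp_virtual_character:
  assumes "\<psi> \<in> irreducible_characters G"
  shows "\<psi> \<in> virtual_characters G"
  unfolding virtual_characters_def using assms
  by (intro CollectI exI[of _ "{\<psi>}"] exI[of _ "\<lambda>_. 1"]) auto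

lemma virtual_character_add:
  assumes "\<phi> \<in> virtual_characters G" "\<psi> \<in> virtual_characters G"
  shows "(\<lambda>g. \<phi> g + \<psi> g) \<in> virtual_characters G"
proof -
  obtain A c where A: "finite A" "A \<subseteq> irreducible_characters G"
    and \<phi>: "\<phi> = (\<lambda>g. \<Sum>\<chi>\<in>A. of_int (c \<chi>) * \<chi> g)"
    using assms(1) unfolding virtual_characters_def by blast
  obtain B d where B: "finite B" "B \<subseteq> irreducible_characters G"
    and \<psi>: "\<psi> = (\<lambda>g. \<Sum>\<chi>\<in>B. of_int (d \<chi>) * \<chi> g)"
    using assms(2) unfolding virtual_characters_def by blast
  define e where "e \<chi> = (if \<chi> \<in> A then c \<chi> else 0) + (if \<chi> \<in> B then d \<chi> else 0)" for \<chi>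
  have "\<phi> g + \<psi> g = (\<Sum>\<chi>\<in>A \<union> B. of_int (e \<chi>) * \<chi> g)" for g
  proof -
    have "\<phi> g = (\<Sum>\<chi>\<in>A \<union> B. of_int (if \<chi> \<in> A then c \<chi> else 0) * \<chi> g)"
      unfolding \<phi> using A B by (intro sum.mono_neutral_cong_left) auto
    moreover have "\<psi> g = (\<Sum>\<chi>\<in>A \<union> B. of_int (if \<chi> \<in> B then d \<chi> else 0) * \<chi> g)"
      unfolding \<psi> using A B by (intro sum.mono_neutral_cong_left) auto
    ultimately show ?thesis
      by (simp only: e_def of_int_add distrib_right sum.distrib)
  qed
  then show ?thesis
    unfolding virtual_characters_def using A B by (intro CollectI exI[of _ "A \<union> B"] exI[of _ e]) auto
qed

lemma virtual_character_of_int_mult: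
  assumes "\<phi> \<in> virtual_characters G"
  shows "(\<lambda>g. of_int m * \<phi> g) \<in> virtual_characters G"
proof -
  obtain A c where A: "finite A" "A \<subseteq> irreducible_characters G"
    and \<phi>: "\<phi> = (\<lambda>g. \<Sum>\<chi>\<in>A. of_int (c \<chi>) * \<chi> g)"
    using assms unfolding virtual_characters_def by blast
  show ?thesis
    unfolding virtual_characters_def \<phi> using A
    by (intro CollectI exI[of _ A] exI[of _ "\<lambda>\<chi>. m * c \<chi>"]) (auto simp: sum_distrib_left mult.assoc)
qed

section \<open>Irreducible representations of degree one and two\<close>

lemma irreducible_rep_degree_1:
  assumes R: "mat_rep G 1 R"
  shows "irreducible_rep G 1 R"
  unfolding irreducible_rep_def
proof (intro conjI allI impI)
  fix W assume "invariant_subspace G 1 R W"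
  then have W: "W \<subseteq> carrier_vec 1" "0\<^sub>v 1 \<in> W" "\<And>c v. v \<in> W \<Longrightarrow> c \<cdot>\<^sub>v v \<in> W"
    by (auto simp: invariant_subspace_def subspace_iff)
  show "W = {0\<^sub>v 1} \<or> W = carrier_vec 1"
  proof (rule disjCI)
    assume "W \<noteq> carrier_vec 1"
    then obtain v where v: "v \<in> carrier_vec 1" "v \<notin> W"
      using W(1) by blast
    have "w = 0\<^sub>v 1" if w: "w \<in> W" for w
    proof (rule ccontr)
      assume "w \<noteq> 0\<^sub>v 1"
      then have "w $ 0 \<noteq> 0"
        using w W(1) by (auto simp: vec_eq_iff)
      then have "v = (v $ 0 / w $ 0) \<cdot>\<^sub>v w"
        using v w W(1) by (auto simp: vec_eq_iff)
      also have "\<dots> \<in> W" by (rule W(3)[OF w])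
      finally show False using v by blast
    qed
    then show "W = {0\<^sub>v 1}" using W(2) by blast
  qed
qed (use R in auto)

lemma linear_character_irreducible:
  assumes "group G" "\<kappa> \<one>\<^bsub>G\<^esub> = 1"
    and "\<And>g h. g \<in> carrier G \<Longrightarrow> h \<in> carrier G \<Longrightarrow> \<kappa> (g \<otimes>\<^bsub>G\<^esub> h) = \<kappa> g * \<kappa> h"
  shows "restrict_fun (carrier G) \<kappa> \<in> irreducible_characters G"
proof -
  have "mat_rep G 1 (\<lambda>g. mat 1 1 (\<lambda>_. \<kappa> g))"
    unfolding mat_rep_def using assms by (auto simp: scalar_prod_def intro!: eq_matI)
  then have "irreducible_rep G 1 (\<lambda>g. mat 1 1 (\<lambda>_. \<kappa> g))"
    by (rule irreducible_rep_degree_1)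
  moreover have "restrict_fun (carrier G) \<kappa> = rep_character G (\<lambda>g. mat 1 1 (\<lambda>_. \<kappa> g))"
    by (simp add: rep_character_def mat_trace_def)
  ultimately show ?thesis
    unfolding irreducible_characters_def by blast
qed

text \<open>
  A proper nonzero invariant subspace of the plane is spanned by a common eigenvector. The
  hypothesis says that there is none, since \<open>w\<close> is an eigenvector of \<open>R g\<close> exactly
  if the determinant of the pair \<open>w\<close>, \<open>R g *\<^sub>v w\<close> vanishes.
\<close>

lemma irreducible_rep_degree_2I:
  assumes R: "mat_rep G 2 R"
    and no_eigen: "\<And>w. w \<in> carrier_vec 2 \<Longrightarrow>
      (\<And>g. g \<in> carrier G \<Longrightarrow> w $ 0 * (R g *\<^sub>v w) $ 1 = w $ 1 * (R g *\<^sub>v w) $ 0) \<Longrightarrow> w = 0\<^sub>v 2"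
  shows "irreducible_rep G 2 R"
  unfolding irreducible_rep_def
proof (intro conjI allI impI)
  fix W assume inv: "invariant_subspace G 2 R W"
  then have W: "W \<subseteq> carrier_vec 2" "0\<^sub>v 2 \<in> W" "\<And>c v. v \<in> W \<Longrightarrow> c \<cdot>\<^sub>v v \<in> W"
      "\<And>v w. v \<in> W \<Longrightarrow> w \<in> W \<Longrightarrow> v + w \<in> W"
    by (auto simp: invariant_subspace_def subspace_iff)
  show "W = {0\<^sub>v 2} \<or> W = carrier_vec 2"
  proof (rule disjCI)
    assume "W \<noteq> carrier_vec 2"
    then obtain v where v: "v \<in> carrier_vec 2" "v \<notin> W"
      using W(1) by blast
    have "w = 0\<^sub>v 2" if w: "w \<in> W" for w
    proof (rule ccontr)
      assume nz: "w \<noteq> 0\<^sub>v 2"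
      have wc: "w \<in> carrier_vec 2" using w W(1) by blast
      obtain g where g: "g \<in> carrier G" "w $ 0 * (R g *\<^sub>v w) $ 1 \<noteq> w $ 1 * (R g *\<^sub>v w) $ 0"
        using no_eigen[OF wc] nz by blast
      define u where "u = R g *\<^sub>v w"
      have u: "u \<in> W" using inv g(1) w by (auto simp: invariant_subspace_def u_def)
      then have uc: "u \<in> carrier_vec 2" using W(1) by blast
      define d where "d = w $ 0 * u $ 1 - w $ 1 * u $ 0"
      have d: "d \<noteq> 0" using g(2) by (simp add: d_def u_def)
      have "v = ((v $ 0 * u $ 1 - v $ 1 * u $ 0) / d) \<cdot>\<^sub>v w + ((w $ 0 * v $ 1 - w $ 1 * v $ 0) / d) \<cdot>\<^sub>v u"
      proof (rule eq_vecI)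
        fix i assume "i < dim_vec (((v $ 0 * u $ 1 - v $ 1 * u $ 0) / d) \<cdot>\<^sub>v w + ((w $ 0 * v $ 1 - w $ 1 * v $ 0) / d) \<cdot>\<^sub>v u)"
        then have i: "i = 0 \<or> i = 1" using uc by auto
        have "v $ i * d = (v $ 0 * u $ 1 - v $ 1 * u $ 0) * w $ i + (w $ 0 * v $ 1 - w $ 1 * v $ 0) * u $ i"
          using i by (auto simp: d_def algebra_simps)
        then have "v $ i = ((v $ 0 * u $ 1 - v $ 1 * u $ 0) * w $ i + (w $ 0 * v $ 1 - w $ 1 * v $ 0) * u $ i) / d"
          using d by (simp add: eq_divide_eq)
        then show "v $ i = (((v $ 0 * u $ 1 - v $ 1 * u $ 0) / d) \<cdot>\<^sub>v w + ((w $ 0 * v $ 1 - w $ 1 * v $ 0) / d) \<cdot>\<^sub>v u) $ i"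
          using uc wc i by (auto simp: add_divide_distrib)
      qed (use uc v in auto)
      also have "\<dots> \<in> W" by (intro W(3,4) u w)
      finally show False using v by blast
    qed
    then show "W = {0\<^sub>v 2}" using W(2) by blast
  qed
qed (use R in auto)

text \<open>
  An action \<open>p\<close> on the points \<open>0, \<dots>, n\<close> permutes the standard basis \<open>e\<close> of a space of
  dimension \<open>n + 1\<close>. This is the matrix of the action on the sum-zero hyperplane in the basis
  \<open>e i - e n\<close> for \<open>i < n\<close>.
\<close>

definition standard_rep :: "nat \<Rightarrow> ('a \<Rightarrow> nat \<Rightarrow> nat) \<Rightarrow> 'a \<Rightarrow> complex mat" where
  "standard_rep n p g = mat n n (\<lambda>(j, i). of_bool (p g i = j) - of_bool (p g n = j))"

lemma standard_rep_mat_rep: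
  assumes one: "\<And>i. i \<le> n \<Longrightarrow> p \<one>\<^bsub>G\<^esub> i = i"
    and le: "\<And>g i. g \<in> carrier G \<Longrightarrow> i \<le> n \<Longrightarrow> p g i \<le> n"
    and mult: "\<And>g h i. g \<in> carrier G \<Longrightarrow> h \<in> carrier G \<Longrightarrow> i \<le> n \<Longrightarrow> p (g \<otimes>\<^bsub>G\<^esub> h) i = p g (p h i)"
  shows "mat_rep G n (standard_rep n p)"
  unfolding mat_rep_def
proof (intro conjI ballI)
  show "standard_rep n p \<one>\<^bsub>G\<^esub> = 1\<^sub>m n"
    by (rule eq_matI) (auto simp: standard_rep_def one)
  fix g h assume g: "g \<in> carrier G" and h: "h \<in> carrier G"
  show "standard_rep n p (g \<otimes>\<^bsub>G\<^esub> h) = standard_rep n p g * standard_rep n p h"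
  proof (rule eq_matI)
    fix j i assume "j < dim_row (standard_rep n p g * standard_rep n p h)"
      "i < dim_col (standard_rep n p g * standard_rep n p h)"
    then have ij: "j < n" "i < n" by (auto simp: standard_rep_def)
    have pick: "(\<Sum>k\<le>n. f k * of_bool (p h i = k)) = f (p h i)" if "i \<le> n" for i and f :: "nat \<Rightarrow> complex"
      using le[OF h that] by (simp add: of_bool_def if_distrib cong: if_cong)
    let ?b = "\<lambda>k. of_bool (p g k = j) - of_bool (p g n = j) :: complex"
    have "(standard_rep n p g * standard_rep n p h) $$ (j, i) =
        (\<Sum>k<n. ?b k * (of_bool (p h i = k) - of_bool (p h n = k)))"
      using ij by (simp add: standard_rep_def scalar_prod_def atLeast0LessThan)
    also have "\<dots> = (\<Sum>k\<le>n. ?b k * (of_bool (p h i = k) - of_bool (p h n = k)))"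
      by (simp add: lessThan_Suc_atMost[symmetric])
    also have "\<dots> = (\<Sum>k\<le>n. ?b k * of_bool (p h i = k)) - (\<Sum>k\<le>n. ?b k * of_bool (p h n = k))"
      by (simp only: right_diff_distrib sum_subtractf)
    also have "\<dots> = ?b (p h i) - ?b (p h n)"
      using ij by (subst (1 2) pick) auto
    also have "\<dots> = standard_rep n p (g \<otimes>\<^bsub>G\<^esub> h) $$ (j, i)"
      using ij mult[OF g h] by (simp add: standard_rep_def)
    finally show "standard_rep n p (g \<otimes>\<^bsub>G\<^esub> h) $$ (j, i) = (standard_rep n p g * standard_rep n p h) $$ (j, i)" ..
  qed (auto simp: standard_rep_def)
qed (simp add: standard_rep_def)

lemma standard_rep_2_irreducible:
  assumes R: "mat_rep G 2 (standard_rep 2 p)"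
    and g: "g \<in> carrier G" "p g 0 = 1" "p g 1 = 0" "p g 2 = 2"
    and h: "h \<in> carrier G" "p h 0 = 2" "p h 1 = 1" "p h 2 = 0"
  shows "irreducible_rep G 2 (standard_rep 2 p)"
proof (rule irreducible_rep_degree_2I[OF R])
  fix w :: "complex vec" assume w: "w \<in> carrier_vec 2"
    and eq: "\<And>k. k \<in> carrier G \<Longrightarrow>
      w $ 0 * (standard_rep 2 p k *\<^sub>v w) $ 1 = w $ 1 * (standard_rep 2 p k *\<^sub>v w) $ 0"
  have 1: "w $ 0 * w $ 0 = w $ 1 * w $ 1"
    using eq[OF g(1)] w g by (simp add: standard_rep_def scalar_prod_def row_def numeral_2_eq_2)
  have 2: "w $ 0 * w $ 1 = w $ 1 * (- w $ 0 - w $ 1)"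
    using eq[OF h(1)] w h by (simp add: standard_rep_def scalar_prod_def row_def numeral_2_eq_2)
  have "w $ 1 = 0"
  proof (rule ccontr)
    assume nz: "w $ 1 \<noteq> 0"
    then have "w $ 0 = - w $ 0 - w $ 1"
      using 2 by (metis mult.commute mult_cancel_left)
    then have "w $ 0 + w $ 0 + w $ 1 = 0" by (simp add: algebra_simps)
    then have "w $ 1 = - (w $ 0 + w $ 0)" by (simp only: eq_neg_iff_add_eq_0 add.commute)
    then show False using 1 nz by auto
  qed
  moreover from this have "w $ 0 = 0"
    using 1 by simp
  ultimately show "w = 0\<^sub>v 2"
    using w by (auto simp: vec_eq_iff less_2_cases_iff)
qed

section \<open>Dihedral groups\<close>

lemma dihedral_group_simps [simp]:
  "carrier (dihedral_group n) = {0..<int n} \<times> UNIV"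
  "\<one>\<^bsub>dihedral_group n\<^esub> = (0, False)"
  "(i, s) \<otimes>\<^bsub>dihedral_group n\<^esub> (j, t) = ((if s then i - j else i + j) mod int n, s \<noteq> t)"
  by (auto simp: dihedral_group_def)

text \<open>
  The last assumption says that \<open>t\<close> inverts \<open>r\<close> by conjugation, which is what the
  multiplication rule of the dihedral group encodes.
\<close>

lemma (in group) dihedral_group_hom:
  assumes r: "r \<in> carrier G" "r [^] n = \<one>" and t: "t \<in> carrier G" "t \<otimes> t = \<one>"
    and conj: "t \<otimes> r \<otimes> t \<otimes> r = \<one>"
  shows "(\<lambda>(i, s). r [^] (i :: int) \<otimes> (if s then t else \<one>)) \<in> hom (dihedral_group n) G"
proof -
  have inv_t: "inv t = t"
    using t by (simp add: inv_equality)
  have inv_r: "t \<otimes> r \<otimes> t = inv r"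
    using r t conj by (intro inv_equality[symmetric]) auto
  have "(\<lambda>x. t \<otimes> x \<otimes> t) \<in> hom G G"
    using t by (auto simp: hom_def m_assoc) (simp add: m_assoc[symmetric])
  then interpret c: group_hom G G "\<lambda>x. t \<otimes> x \<otimes> t"
    by unfold_locales
  have flip: "t \<otimes> r [^] i = r [^] (- i) \<otimes> t" for i :: int
  proof -
    have "t \<otimes> r [^] i \<otimes> t = r [^] (- i)"
      using c.hom_int_pow[OF r(1), of i] r(1) by (simp add: inv_r int_pow_neg int_pow_inv)
    then have "t \<otimes> r [^] i \<otimes> t \<otimes> t = r [^] (- i) \<otimes> t" by simp
    then show ?thesis using t r(1) by (simp add: m_assoc)
  qed
  have mod: "r [^] (i mod int n) = r [^] i" for i :: int
  proof -
    have "r [^] i = r [^] (int n * (i div int n) + i mod int n)" by simp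
    also have "\<dots> = (r [^] int n) [^] (i div int n) \<otimes> r [^] (i mod int n)"
      using r(1) by (simp only: int_pow_mult int_pow_pow)
    also have "r [^] int n = \<one>"
      using r(2) by (simp add: int_pow_int)
    finally show ?thesis using r(1) by simp
  qed
  show ?thesis
  proof (rule homI)
    fix x y assume "x \<in> carrier (dihedral_group n)" "y \<in> carrier (dihedral_group n)"
    obtain i s where x: "x = (i, s)" by force
    obtain j u where y: "y = (j, u)" by force
    have "t \<otimes> (r [^] j \<otimes> z) = r [^] (- j) \<otimes> (t \<otimes> z)" if "z \<in> carrier G" for z
      using that r(1) t(1) flip[of j] by (simp add: m_assoc[symmetric])
    then show "(case x \<otimes>\<^bsub>dihedral_group n\<^esub> y of (i, s) \<Rightarrow> r [^] i \<otimes> (if s then t else \<one>)) =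
        (case x of (i, s) \<Rightarrow> r [^] i \<otimes> (if s then t else \<one>)) \<otimes>
        (case y of (i, s) \<Rightarrow> r [^] i \<otimes> (if s then t else \<one>))"
      using r(1) t unfolding x y
      by (cases s; cases u) (simp_all add: mod flip int_pow_mult int_pow_diff int_pow_neg m_assoc)
  qed (use r(1) t in auto)
qed

text \<open>
  The representation induced from the linear character of the rotation subgroup that sends the
  generating rotation to \<open>\<zeta>\<close>.
\<close>

definition dihedral_rep :: "complex \<Rightarrow> int \<times> bool \<Rightarrow> complex mat" where
  "dihedral_rep \<zeta> = (\<lambda>(i, s). mat 2 2 (\<lambda>(a, b).
     if s = (a = b) then 0 else if a = 0 then \<zeta> powi i else \<zeta> powi (- i)))"

lemma power_int_mod_root_of_unity:
  fixes \<zeta> :: complex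
  assumes "\<zeta> ^ n = 1" "n > 0"
  shows "\<zeta> powi (i mod int n) = \<zeta> powi i"
proof -
  have nz: "\<zeta> \<noteq> 0" using assms by (auto simp: zero_power)
  have "\<zeta> powi i = \<zeta> powi (int n * (i div int n) + i mod int n)" by simp
  also have "\<dots> = (\<zeta> powi int n) powi (i div int n) * \<zeta> powi (i mod int n)"
    by (subst power_int_add) (simp_all only: power_int_mult nz simp_thms)
  finally show ?thesis using assms by simp
qed

lemma dihedral_rep_mat_rep:
  assumes \<zeta>: "\<zeta> ^ n = 1" "n > 0"
  shows "mat_rep (dihedral_group n) 2 (dihedral_rep \<zeta>)"
  unfolding mat_rep_def
proof (intro conjI ballI)
  have nz: "\<zeta> \<noteq> 0" using \<zeta> by (auto simp: zero_power)
  show "dihedral_rep \<zeta> \<one>\<^bsub>dihedral_group n\<^esub> = 1\<^sub>m 2"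
    by (rule eq_matI) (auto simp: dihedral_rep_def)
  fix x y assume "x \<in> carrier (dihedral_group n)" "y \<in> carrier (dihedral_group n)"
  obtain i s where x: "x = (i, s)" by force
  obtain j t where y: "y = (j, t)" by force
  have neg: "\<zeta> powi (- (k mod int n)) = \<zeta> powi (- k)" for k
    using power_int_mod_root_of_unity[OF \<zeta>] by (simp add: power_int_minus)
  show "dihedral_rep \<zeta> (x \<otimes>\<^bsub>dihedral_group n\<^esub> y) = dihedral_rep \<zeta> x * dihedral_rep \<zeta> y"
  proof (rule eq_matI)
    fix a b assume "a < dim_row (dihedral_rep \<zeta> x * dihedral_rep \<zeta> y)"
      "b < dim_col (dihedral_rep \<zeta> x * dihedral_rep \<zeta> y)"
    then have ab: "a = 0 \<or> a = 1" "b = 0 \<or> b = 1"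
      by (auto simp: dihedral_rep_def x y)
    have sum2: "sum f {0..<2} = f 0 + f (1::nat)" for f :: "nat \<Rightarrow> complex"
      by (simp add: numeral_2_eq_2)
    show "dihedral_rep \<zeta> (x \<otimes>\<^bsub>dihedral_group n\<^esub> y) $$ (a, b) = (dihedral_rep \<zeta> x * dihedral_rep \<zeta> y) $$ (a, b)"
      using ab nz unfolding x y
      by (cases s; cases t; elim disjE)
        (simp_all add: dihedral_rep_def scalar_prod_def sum2 neg power_int_mod_root_of_unity[OF \<zeta>]
          power_int_add[symmetric] algebra_simps)
  qed (auto simp: dihedral_rep_def x y)
qed (auto simp: dihedral_rep_def)

lemma dihedral_rep_trace:
  "mat_trace (dihedral_rep \<zeta> (i, s)) = (if s then 0 else \<zeta> powi i + \<zeta> powi (- i))"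
  by (simp add: mat_trace_def dihedral_rep_def numeral_2_eq_2)

lemma dihedral_rep_irreducible:
  assumes \<zeta>: "\<zeta> ^ n = 1" "n > 1" "\<zeta> ^ 2 \<noteq> 1"
  shows "irreducible_rep (dihedral_group n) 2 (dihedral_rep \<zeta>)"
proof (rule irreducible_rep_degree_2I)
  show "mat_rep (dihedral_group n) 2 (dihedral_rep \<zeta>)"
    using \<zeta> by (intro dihedral_rep_mat_rep) auto
  have nz: "\<zeta> \<noteq> 0" using \<zeta> by (auto simp: zero_power)
  fix w :: "complex vec" assume w: "w \<in> carrier_vec 2"
    and eq: "\<And>g. g \<in> carrier (dihedral_group n) \<Longrightarrow>
      w $ 0 * (dihedral_rep \<zeta> g *\<^sub>v w) $ 1 = w $ 1 * (dihedral_rep \<zeta> g *\<^sub>v w) $ 0"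
  have 1: "w $ 0 * w $ 0 = w $ 1 * w $ 1"
    using eq[of "(0, True)"] w \<zeta>
    by (simp add: dihedral_rep_def scalar_prod_def row_def numeral_2_eq_2)
  have "w $ 0 * (w $ 1 / \<zeta>) = w $ 1 * (w $ 0 * \<zeta>)"
    using eq[of "(1, False)"] w \<zeta>
    by (simp add: dihedral_rep_def scalar_prod_def row_def numeral_2_eq_2 power_int_minus field_simps)
  then have "w $ 0 * w $ 1 * (\<zeta> ^ 2 - 1) = 0"
    using nz by (simp add: field_simps power2_eq_square)
  then have "w $ 0 = 0 \<or> w $ 1 = 0"
    using \<zeta>(3) by auto
  with 1 have "w $ 0 = 0" "w $ 1 = 0" by auto
  then show "w = 0\<^sub>v 2"
    using w by (auto simp: vec_eq_iff less_2_cases_iff)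
qed

lemma irreducible_rep_comp_surj_hom:
  assumes "group G" "group H" and \<phi>: "\<phi> \<in> hom G H" "\<phi> ` carrier G = carrier H"
    and irr: "irreducible_rep H n R"
  shows "irreducible_rep G n (\<lambda>g. R (\<phi> g))"
proof -
  interpret group_hom G H \<phi>
    using assms by (simp add: group_hom_def group_hom_axioms_def)
  have "mat_rep G n (\<lambda>g. R (\<phi> g))"
    using irr \<phi>(2) by (auto simp: irreducible_rep_def mat_rep_def)
  moreover have "invariant_subspace H n R W" if "invariant_subspace G n (\<lambda>g. R (\<phi> g)) W" for W
    using that \<phi>(2)[symmetric] by (auto simp: invariant_subspace_def)
  ultimately show ?thesis
    using irr by (auto simp: irreducible_rep_def)
qed


section \<open>Virtual characters of the dihedral group of order eight\<close>

text \<open>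
  The two flags select which of the generators, rotation and reflection, is sent to \<open>- 1\<close>. For
  even \<open>n\<close> the four choices are the linear characters of the dihedral group.
\<close>

definition dihedral_sign :: "bool \<Rightarrow> bool \<Rightarrow> int \<times> bool \<Rightarrow> complex" where
  "dihedral_sign a b = (\<lambda>(i, s). (if a \<and> odd i then - 1 else 1) * (if b \<and> s then - 1 else 1))"

lemma dihedral_sign_mult:
  assumes "even n"
  shows "dihedral_sign a b (x \<otimes>\<^bsub>dihedral_group n\<^esub> y) = dihedral_sign a b x * dihedral_sign a b y"
proof -
  have "even (k mod int n) \<longleftrightarrow> even k" for k
    using assms by (simp add: dvd_mod_iff)
  then show ?thesis
    by (cases x; cases y) (auto simp: dihedral_sign_def)
qed

lemma dihedral_8_cases:
  assumes "x \<in> carrier (dihedral_group 4)"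
  obtains s where "x = (0, s)" | s where "x = (1, s)" | s where "x = (2, s)" | s where "x = (3, s)"
proof -
  obtain i s where x: "x = (i, s)" by force
  have "i = 0 \<or> i = 1 \<or> i = 2 \<or> i = 3"
    using assms x by auto
  then show thesis using that x by blast
qed

lemma regular_character_eq:
  assumes "group G" "finite (carrier G)" "g \<in> carrier G"
  shows "regular_character G g = (if g = \<one>\<^bsub>G\<^esub> then of_nat (card (carrier G)) else 0)"
proof -
  interpret group G by fact
  have "(\<Sum>x\<in>carrier G. if g \<otimes>\<^bsub>G\<^esub> x = x then 1 else 0 :: complex) =
      (\<Sum>x\<in>carrier G. if g = \<one>\<^bsub>G\<^esub> then 1 else 0)"
    using assms(3) by (intro sum.cong refl if_cong) (auto simp: r_cancel_one)
  then show ?thesis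
    using assms(3) by (simp add: regular_character_def restrict_fun_def)
qed

text \<open>
  Transported to the dihedral group, the restricted character is \<open>2\<close> on elements with even
  rotation part and \<open>0\<close> elsewhere; it is the sum of two linear characters, and the regular
  character is the sum of the four linear characters and twice the faithful character \<open>\<psi>\<close> of
  degree two. The combination has degree two and vanishes precisely at odd rotation parts,
  because \<open>u\<close> is odd and hence nonzero. The character \<open>\<psi>\<close> also has degree two but vanishes on all
  elements outside the centre, so it lies strictly below the combination.
\<close>

lemma dihedral_8_virtual_combination:
  assumes H: "group H" and \<phi>: "\<phi> \<in> iso H (dihedral_group 4)"
    and uv: "2 * u + 8 * v = (2 :: int)"
    and \<chi>: "\<chi> = (\<lambda>g. of_int u * restrict_fun (carrier H) (\<lambda>g. if even (fst (\<phi> g)) then 2 else 0) g +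
        of_int v * regular_character H g)"
  shows "\<chi> \<in> pos_virtual_characters H" "\<not> minimal_vchar H \<chi>"
proof -
  interpret group H by fact
  have hom: "\<phi> \<in> hom H (dihedral_group 4)" and bij: "bij_betw \<phi> (carrier H) (carrier (dihedral_group 4))"
    using \<phi> by (auto simp: iso_def)
  have surj: "\<phi> ` carrier H = carrier (dihedral_group 4)"
    using bij by (simp add: bij_betw_def)
  have fin: "finite (carrier H)" and card: "card (carrier H) = 8"
    using bij_betw_finite[OF bij] bij_betw_same_card[OF bij] by (simp_all add: card_cartesian_product)
  have in_D: "\<phi> g \<in> carrier (dihedral_group 4)" if "g \<in> carrier H" for g
    using that surj by blast
  have \<phi>_one: "\<phi> \<one>\<^bsub>H\<^esub> = (0, False)"
  proof -
    obtain i s where e: "\<phi> \<one>\<^bsub>H\<^esub> = (i, s)" by force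
    have "\<phi> \<one>\<^bsub>H\<^esub> \<otimes>\<^bsub>dihedral_group 4\<^esub> \<phi> \<one>\<^bsub>H\<^esub> = \<phi> \<one>\<^bsub>H\<^esub>"
      using hom_mult[OF hom one_closed one_closed] by simp
    then have mult: "(i, s) \<otimes>\<^bsub>dihedral_group 4\<^esub> (i, s) = (i, s)"
      unfolding e .
    then have s: "\<not> s" by auto
    with mult have i: "(i + i) mod 4 = i" by simp
    have "0 \<le> i" "i < 4"
      using in_D[OF one_closed] e by simp_all
    with i have "i = 0" by presburger
    then show ?thesis using e s by simp
  qed
  have \<phi>_one_iff: "\<phi> g = (0, False) \<longleftrightarrow> g = \<one>\<^bsub>H\<^esub>" if "g \<in> carrier H" for g
    using bij that one_closed \<phi>_one unfolding bij_betw_def inj_on_def by metis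
  define \<kappa> where "\<kappa> a b = restrict_fun (carrier H) (\<lambda>g. dihedral_sign a b (\<phi> g))" for a b
  define \<psi> where "\<psi> = rep_character H (\<lambda>g. dihedral_rep \<i> (\<phi> g))"
  have \<kappa>_irr: "\<kappa> a b \<in> virtual_characters H" for a b
    unfolding \<kappa>_def
    by (intro irreducible_imp_virtual_character linear_character_irreducible[OF H])
      (simp_all add: \<phi>_one hom_mult[OF hom] dihedral_sign_mult, simp add: dihedral_sign_def)
  have D: "group (dihedral_group 4)"
    using iso_imp_img_group[OF \<phi>] by (simp add: \<phi>_one dihedral_group_def)
  have "irreducible_rep (dihedral_group 4) 2 (dihedral_rep \<i>)"
    by (rule dihedral_rep_irreducible) (simp_all add: power4_eq_xxxx)
  then have irr: "irreducible_rep H 2 (\<lambda>g. dihedral_rep \<i> (\<phi> g))"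
    by (rule irreducible_rep_comp_surj_hom[OF H D hom surj])
  then have \<psi>_virt: "\<psi> \<in> virtual_characters H"
    unfolding \<psi>_def irreducible_characters_def
    by (intro irreducible_imp_virtual_character) (auto simp: irreducible_characters_def)
  have \<psi>_deg: "char_degree H \<psi> = 2"
    unfolding \<psi>_def using irr by (subst char_degree_rep_character[OF H]) (auto simp: irreducible_rep_def)
  have pow: "\<i> powi 2 = - 1" "\<i> powi 3 = - \<i>" "\<i> powi (- 2) = - 1" "\<i> powi (- 3) = \<i>"
      "\<i> powi (- 1) = - \<i>"
    by (simp_all add: power_int_def power3_eq_cube)
  have \<psi>_eq: "\<psi> g = (if \<phi> g = (0, False) then 2 else if \<phi> g = (2, False) then - 2 else 0)"
    if "g \<in> carrier H" for g
    using in_D[OF that]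
    by (cases rule: dihedral_8_cases) (auto simp: that \<psi>_def rep_character_def restrict_fun_def dihedral_rep_trace pow power3_eq_cube)
  have \<chi>_eq: "\<chi> g = of_int u * (if even (fst (\<phi> g)) then 2 else 0) + of_int v * (if \<phi> g = (0, False) then 8 else 0)"
    if "g \<in> carrier H" for g
    using that regular_character_eq[OF H fin that]
    by (simp add: \<chi> restrict_fun_def card \<phi>_one_iff)
  have "\<chi> = (\<lambda>g. of_int u * (\<kappa> False False g + \<kappa> True False g) + of_int v *
      (\<kappa> False False g + \<kappa> True False g + (\<kappa> False True g + \<kappa> True True g) + of_int 2 * \<psi> g))"
  proof
    fix g
    show "\<chi> g = of_int u * (\<kappa> False False g + \<kappa> True False g) + of_int v *
      (\<kappa> False False g + \<kappa> True False g + (\<kappa> False True g + \<kappa> True True g) + of_int 2 * \<psi> g)"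
    proof (cases "g \<in> carrier H")
      case True
      from in_D[OF True] show ?thesis
        by (cases rule: dihedral_8_cases)
          (auto simp: \<chi>_eq[OF True] \<psi>_eq[OF True] \<kappa>_def restrict_fun_def dihedral_sign_def True algebra_simps)
    next
      case False
      then show ?thesis
        by (simp add: \<chi> \<kappa>_def \<psi>_def rep_character_def regular_character_def restrict_fun_def)
    qed
  qed
  also have "\<dots> \<in> virtual_characters H"
    by (intro virtual_character_add virtual_character_of_int_mult \<kappa>_irr \<psi>_virt)
  finally have \<chi>_virt: "\<chi> \<in> virtual_characters H" .
  have "\<chi> \<one>\<^bsub>H\<^esub> = of_int (2 * u + 8 * v)"
    by (simp add: \<chi>_eq \<phi>_one)
  then have \<chi>_deg: "char_degree H \<chi> = 2"
    by (simp add: char_degree_def uv)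
  show "\<chi> \<in> pos_virtual_characters H"
    using \<chi>_virt \<chi>_deg by (simp add: pos_virtual_characters_def)
  have u: "u \<noteq> 0" using uv by presburger
  have "complex_of_int (2 * u + 8 * v) = 2"
    unfolding uv by simp
  then have deg_nz: "complex_of_int u * 2 + complex_of_int v * 8 \<noteq> 0"
    by (simp add: mult.commute)
  have "\<psi> \<in> pos_virtual_characters H"
    using \<psi>_virt \<psi>_deg by (simp add: pos_virtual_characters_def)
  moreover have "vchar_le H \<psi> \<chi>"
    unfolding vchar_le_def using \<psi>_deg \<chi>_deg u deg_nz by (auto simp: \<psi>_eq \<chi>_eq)
  moreover have "\<not> vchar_le H \<chi> \<psi>"
  proof -
    have "(0, True) \<in> \<phi> ` carrier H"
      using surj by simp
    then obtain g where g: "g \<in> carrier H" "\<phi> g = (0, True)" by force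
    then have "\<psi> g = 0" "\<chi> g \<noteq> 0"
      using u by (simp_all add: \<psi>_eq \<chi>_eq)
    then show ?thesis using g(1) by (auto simp: vchar_le_def)
  qed
  ultimately show "\<not> minimal_vchar H \<chi>"
    by (auto simp: minimal_vchar_def)
qed

section \<open>The symmetric group on four points\<close>

text \<open>
  Permutations of \<open>1, \<dots>, 4\<close> in one-line notation. They turn statements about all elements of
  the group into finite checks that the simplifier can evaluate. Composition shifts the index
  because the points are numbered from \<open>1\<close> and list positions from \<open>0\<close>.
\<close>

definition perm_lists :: "nat list list" where
  "perm_lists = filter distinct (List.n_lists 4 [1, 2, 3, 4])"

definition list_comp :: "nat list \<Rightarrow> nat list \<Rightarrow> nat list" where
  "list_comp l m = map (\<lambda>i. l ! (i - 1)) m"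

definition odd_list :: "nat list \<Rightarrow> bool" where
  "odd_list l \<longleftrightarrow> odd (length [(i, j). i \<leftarrow> [0, 1, 2, 3], j \<leftarrow> [0, 1, 2, 3], i < j \<and> l ! j < l ! i])"

definition klein_lists :: "nat list list" where
  "klein_lists = [[1, 2, 3, 4], [2, 1, 4, 3], [3, 4, 1, 2], [4, 3, 2, 1]]"

definition one_line :: "(nat \<Rightarrow> nat) \<Rightarrow> nat list" where
  "one_line g = map g [1, 2, 3, 4]"

abbreviation S4 :: "(nat \<Rightarrow> nat) monoid" where
  "S4 \<equiv> sym_group 4"

interpretation S4: group S4
  by (rule sym_group_is_group)

lemmas S4_simps [simp] = sym_group_mult sym_group_one

lemma atLeastAtMost_1_4: "{1..4} = {1, 2, 3, 4 :: nat}"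
  by auto

lemma finite_S4 [simp]: "finite (carrier S4)"
  by (simp add: sym_group_def finite_permutations)

lemma card_S4: "card (carrier S4) = 24"
  by (simp add: sym_group_def card_permutations fact_numeral)

lemma distinct_perm_lists: "distinct perm_lists" and length_perm_lists: "length perm_lists = 24"
  by code_simp+

lemma S4_apply:
  assumes "g \<in> carrier S4" "i \<in> {1, 2, 3, 4}"
  shows "g i \<in> {1, 2, 3, 4}"
  using permutes_in_image[of g "{1..4}" i] assms by (simp only: sym_group_carrier atLeastAtMost_1_4)

lemma one_line_bij: "bij_betw one_line (carrier S4) (set perm_lists)"
proof -
  have inj: "inj_on one_line (carrier S4)"
  proof (rule inj_onI)
    fix g h assume "g \<in> carrier S4" "h \<in> carrier S4" and eq: "one_line g = one_line h"
    then have g: "g permutes {1, 2, 3, 4}" and h: "h permutes {1, 2, 3, 4}"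
      by (simp_all only: sym_group_carrier atLeastAtMost_1_4)
    then have "g i = h i" if "i \<notin> {1, 2, 3, 4}" for i
      using that permutes_not_in[OF g, of i] permutes_not_in[OF h, of i] by simp
    moreover have "g i = h i" if "i \<in> {1, 2, 3, 4}" for i
      using that eq by (auto simp: one_line_def)
    ultimately show "g = h" by blast
  qed
  have sub: "one_line ` carrier S4 \<subseteq> set perm_lists"
  proof
    fix l assume "l \<in> one_line ` carrier S4"
    then obtain g where g: "g \<in> carrier S4" "l = one_line g" by blast
    have "inj g" using g(1) by (auto simp: sym_group_carrier permutes_inj)
    then have "distinct (one_line g)"
      by (simp add: one_line_def inj_eq)
    moreover have "set (one_line g) \<subseteq> {1, 2, 3, 4}"
      using S4_apply[OF g(1)] by (auto simp: one_line_def simp del: insert_iff)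
    ultimately show "l \<in> set perm_lists"
      unfolding g(2) perm_lists_def by (simp add: set_n_lists) (simp add: one_line_def)
  qed
  have "card (one_line ` carrier S4) = card (set perm_lists)"
    using card_image[OF inj] card_S4 distinct_card[OF distinct_perm_lists] length_perm_lists by simp
  then have "one_line ` carrier S4 = set perm_lists"
    using sub by (intro card_subset_eq) auto
  with inj show ?thesis by (simp add: bij_betw_def)
qed

lemma one_line_in: "g \<in> carrier S4 \<Longrightarrow> one_line g \<in> set perm_lists"
  using one_line_bij by (auto simp: bij_betw_def)

lemma one_line_eq_iff:
  "g \<in> carrier S4 \<Longrightarrow> h \<in> carrier S4 \<Longrightarrow> one_line g = one_line h \<longleftrightarrow> g = h"
  using one_line_bij by (auto simp: bij_betw_def inj_on_def)

lemma one_line_obtain: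
  assumes "l \<in> set perm_lists"
  obtains g where "g \<in> carrier S4" "one_line g = l"
proof -
  have "l \<in> one_line ` carrier S4"
    using assms one_line_bij by (simp add: bij_betw_def)
  then show thesis using that by (elim imageE) simp
qed

lemma one_line_comp:
  assumes "h \<in> carrier S4"
  shows "one_line (g \<circ> h) = list_comp (one_line g) (one_line h)"
proof -
  have nth: "one_line g ! (i - 1) = g i" if "i \<in> {1, 2, 3, 4}" for i
    using that by (auto simp: one_line_def)
  have "list_comp (one_line g) (one_line h) = map (\<lambda>i. one_line g ! (h i - 1)) [1, 2, 3, 4]"
    by (simp add: list_comp_def one_line_def)
  also have "\<dots> = map (\<lambda>i. g (h i)) [1, 2, 3, 4]"
    using nth[OF S4_apply[OF assms]] by (intro map_cong refl) simp
  finally show ?thesis by (simp add: one_line_def)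
qed

lemma one_line_id [simp]: "one_line id = [1, 2, 3, 4]"
  by (simp add: one_line_def)

lemma S4_comp_closed [intro, simp]: "g \<in> carrier S4 \<Longrightarrow> h \<in> carrier S4 \<Longrightarrow> g \<circ> h \<in> carrier S4"
  using S4.m_closed[of g h] by simp

lemma S4_id [simp]: "id \<in> carrier S4"
  using S4.one_closed by simp

definition odd_perms :: "(nat \<Rightarrow> nat) set" where
  "odd_perms = {g \<in> carrier S4. odd_list (one_line g)}"

definition klein :: "(nat \<Rightarrow> nat) set" where
  "klein = {g \<in> carrier S4. one_line g \<in> set klein_lists}"

definition S4_three_cycles :: "(nat \<Rightarrow> nat) set" where
  "S4_three_cycles = carrier S4 - odd_perms - klein"

lemma klein_subset: "klein \<subseteq> carrier S4" and odd_perms_subset: "odd_perms \<subseteq> carrier S4"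
  and three_cycles_subset: "S4_three_cycles \<subseteq> carrier S4"
  by (auto simp: klein_def odd_perms_def S4_three_cycles_def)

text \<open>
  Conjugation permutes the three nonidentity elements of the Klein four-group. They are numbered
  \<open>0\<close>, \<open>1\<close>, \<open>2\<close> in the order of the list, whose head is the identity. The image \<open>j\<close> of
  \<open>i\<close> under \<open>g\<close> is found from \<open>g v\<^sub>i = v\<^sub>j g\<close>, which avoids inverses.
\<close>

definition klein_action_list :: "nat list \<Rightarrow> nat \<Rightarrow> nat" where
  "klein_action_list l i =
     (let m = list_comp l (klein_lists ! Suc i)
      in if m = list_comp (klein_lists ! 1) l then 0
         else if m = list_comp (klein_lists ! 2) l then 1 else 2)"

lemma klein_lists_subset: "set klein_lists \<subseteq> set perm_lists"
  by code_simp

lemma odd_list_comp: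
  "\<forall>l\<in>set perm_lists. \<forall>m\<in>set perm_lists. odd_list (list_comp l m) \<longleftrightarrow> odd_list l \<noteq> odd_list m"
  by code_simp

lemma klein_lists_closed:
  "\<forall>l\<in>set klein_lists. \<not> odd_list l \<and> list_comp l l = [1, 2, 3, 4] \<and>
     (\<forall>m\<in>set klein_lists. list_comp l m \<in> set klein_lists)"
  by code_simp

lemma klein_lists_normal:
  "\<forall>l\<in>set perm_lists. \<forall>m\<in>set klein_lists. \<exists>m'\<in>set klein_lists. list_comp l m = list_comp m' l"
  by code_simp

lemma klein_lists_conj:
  "\<forall>m\<in>set klein_lists. m \<noteq> [1, 2, 3, 4] \<longrightarrow>
     (\<exists>l\<in>set perm_lists. list_comp l m = list_comp [2, 1, 4, 3] l)"
  by code_simp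

lemma three_cycle_lists:
  "\<forall>m\<in>set perm_lists. \<not> odd_list m \<longrightarrow> m \<notin> set klein_lists \<longrightarrow>
     list_comp (list_comp m m) m = [1, 2, 3, 4] \<and>
     \<not> odd_list (list_comp m m) \<and> list_comp m m \<notin> set klein_lists \<and>
     (\<exists>l\<in>set perm_lists. list_comp l m = list_comp [2, 3, 1, 4] l)"
  by code_simp

text \<open>
  Transpositions and 4-cycles are different conjugacy classes, but modulo the Klein four-group
  all odd permutations are conjugate.
\<close>

lemma odd_lists_conj:
  "\<forall>m\<in>set perm_lists. odd_list m \<longrightarrow>
     (\<exists>l\<in>set perm_lists. \<exists>v\<in>set klein_lists. list_comp l m = list_comp (list_comp [2, 1, 3, 4] v) l)"
  by code_simp

text \<open>
  Multiplying a transposition by a suitable element of the Klein four-group gives a 4-cycle, and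
  the two elements of the four-group that are not powers of a 4-cycle invert it. The last
  conjunct lists the even elements of the resulting dihedral group.
\<close>

lemma odd_lists_dihedral:
  "\<forall>m\<in>set perm_lists. odd_list m \<longrightarrow> (\<exists>v\<in>set klein_lists. \<exists>t\<in>set klein_lists.
     let r = list_comp m v; r2 = list_comp r r
     in list_comp r2 r2 = [1, 2, 3, 4] \<and> list_comp (list_comp (list_comp t r) t) r = [1, 2, 3, 4] \<and>
        distinct [[1, 2, 3, 4], r2, t, list_comp r2 t])"
  by code_simp

lemma card_lists:
  "length (filter odd_list perm_lists) = 12"
  "length (filter (\<lambda>l. l \<in> set klein_lists) perm_lists) = 4"
  "length (filter (\<lambda>l. \<not> odd_list l \<and> l \<notin> set klein_lists) perm_lists) = 8"
  by code_simp+

lemma klein_action_lists: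
  "\<forall>l\<in>set perm_lists. \<forall>m\<in>set perm_lists. \<forall>i\<in>{0, 1, 2}.
     klein_action_list (list_comp l m) i = klein_action_list l (klein_action_list m i)"
  "\<forall>i\<in>{0, 1, 2}. klein_action_list [1, 2, 3, 4] i = i"
  "map (klein_action_list [1, 3, 2, 4]) [0, 1, 2] = [1, 0, 2]"
  "map (klein_action_list [1, 4, 3, 2]) [0, 1, 2] = [2, 1, 0]"
  by code_simp+

section \<open>Conjugacy and counting in the symmetric group\<close>

lemma odd_perms_comp:
  assumes "g \<in> carrier S4" "h \<in> carrier S4"
  shows "g \<circ> h \<in> odd_perms \<longleftrightarrow> (g \<in> odd_perms) \<noteq> (h \<in> odd_perms)"
  using assms odd_list_comp one_line_in by (auto simp: odd_perms_def one_line_comp)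

lemma klein_not_odd: "v \<in> klein \<Longrightarrow> v \<notin> odd_perms"
  using klein_lists_closed by (auto simp: odd_perms_def klein_def)

lemma id_in_klein [simp]: "id \<in> klein"
  by (simp add: klein_def klein_lists_def)

lemma klein_square:
  assumes "v \<in> klein"
  shows "v \<circ> v = id"
proof -
  have "one_line (v \<circ> v) = one_line id"
    using assms klein_lists_closed by (simp add: klein_def one_line_comp)
  then show ?thesis using assms by (subst (asm) one_line_eq_iff) (auto simp: klein_def)
qed

lemma klein_subgroup: "subgroup klein S4"
proof (rule S4.subgroupI)
  fix v assume v: "v \<in> klein"
  then have "inv\<^bsub>S4\<^esub> v = v"
    using klein_square[OF v] by (intro S4.inv_equality) (auto simp: klein_def)
  then show "inv\<^bsub>S4\<^esub> v \<in> klein" using v by simp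
next
  fix v w assume "v \<in> klein" "w \<in> klein"
  then show "v \<otimes>\<^bsub>S4\<^esub> w \<in> klein"
    using klein_lists_closed by (auto simp: klein_def one_line_comp)
qed (use id_in_klein klein_subset in blast)+

lemma klein_normal: "klein \<lhd> S4"
proof (rule S4.normal_invI[OF klein_subgroup])
  fix g v assume g: "g \<in> carrier S4" and v: "v \<in> klein"
  obtain m where m: "m \<in> set klein_lists" "list_comp (one_line g) (one_line v) = list_comp m (one_line g)"
    using klein_lists_normal one_line_in[OF g] v by (auto simp: klein_def)
  obtain w where w: "w \<in> carrier S4" "one_line w = m"
    using one_line_obtain m(1) klein_lists_subset by blast
  have vG: "v \<in> carrier S4" using v by (simp add: klein_def)
  have "one_line (g \<circ> v) = one_line (w \<circ> g)"
    using m(2) w(2) g vG by (simp add: one_line_comp)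
  then have "g \<circ> v = w \<circ> g"
    using g w(1) vG by (subst (asm) one_line_eq_iff) auto
  then have "g \<otimes>\<^bsub>S4\<^esub> v \<otimes>\<^bsub>S4\<^esub> inv\<^bsub>S4\<^esub> g = w \<otimes>\<^bsub>S4\<^esub> g \<otimes>\<^bsub>S4\<^esub> inv\<^bsub>S4\<^esub> g"
    by (simp only: S4_simps)
  also have "\<dots> = w \<otimes>\<^bsub>S4\<^esub> (g \<otimes>\<^bsub>S4\<^esub> inv\<^bsub>S4\<^esub> g)"
    by (rule S4.m_assoc[OF w(1) g S4.inv_closed[OF g]])
  also have "\<dots> = w"
    using g w(1) by (simp only: S4.r_inv S4.r_one)
  finally show "g \<otimes>\<^bsub>S4\<^esub> v \<otimes>\<^bsub>S4\<^esub> inv\<^bsub>S4\<^esub> g \<in> klein"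
    using w m(1) by (simp add: klein_def)
qed

lemma obtain_conjugator:
  assumes "g \<in> carrier S4" "h \<in> carrier S4"
    and "\<exists>l\<in>set perm_lists. list_comp l (one_line g) = list_comp (one_line h) l"
  obtains k where "k \<in> carrier S4" "k \<circ> g = h \<circ> k"
proof -
  obtain l where l: "l \<in> set perm_lists" "list_comp l (one_line g) = list_comp (one_line h) l"
    using assms(3) by blast
  obtain k where k: "k \<in> carrier S4" "one_line k = l"
    using one_line_obtain[OF l(1)] by blast
  have "one_line (k \<circ> g) = one_line (h \<circ> k)"
    using l k assms by (simp add: one_line_comp)
  then have "k \<circ> g = h \<circ> k"
    using k assms by (subst (asm) one_line_eq_iff) auto
  with k(1) show thesis by (rule that)
qed

definition is_class_function :: "((nat \<Rightarrow> nat) \<Rightarrow> complex) \<Rightarrow> bool" where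
  "is_class_function f \<longleftrightarrow>
     (\<forall>g\<in>carrier S4. \<forall>h\<in>carrier S4. \<forall>k\<in>carrier S4. k \<circ> g = h \<circ> k \<longrightarrow> f g = f h)"

lemma class_function_conj:
  assumes "is_class_function f" "g \<in> carrier S4" "h \<in> carrier S4"
    and "\<exists>l\<in>set perm_lists. list_comp l (one_line g) = list_comp (one_line h) l"
  shows "f g = f h"
  using obtain_conjugator[OF assms(2-4)] assms(1-3) unfolding is_class_function_def by metis

lemma class_function_klein:
  assumes f: "is_class_function f" and v: "v \<in> klein - {id}" and w: "w \<in> klein - {id}"
  shows "f v = f w"
proof -
  obtain k where k: "k \<in> carrier S4" "one_line k = [2, 1, 4, 3]"
    by (rule one_line_obtain[of "[2, 1, 4, 3]"]) (use klein_lists_subset in \<open>simp add: klein_lists_def\<close>)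
  have "f u = f k" if u: "u \<in> klein - {id}" for u
  proof (rule class_function_conj[OF f])
    show uG: "u \<in> carrier S4" using u by (simp add: klein_def)
    then have "one_line u \<noteq> [1, 2, 3, 4]"
      using u one_line_eq_iff[of u id] by simp
    then show "\<exists>l\<in>set perm_lists. list_comp l (one_line u) = list_comp (one_line k) l"
      using klein_lists_conj u k(2) by (simp add: klein_def)
  qed (rule k(1))
  then show ?thesis using v w by simp
qed

lemma three_cycles_iff:
  "g \<in> S4_three_cycles \<longleftrightarrow> g \<in> carrier S4 \<and> \<not> odd_list (one_line g) \<and> one_line g \<notin> set klein_lists"
  by (auto simp: S4_three_cycles_def odd_perms_def klein_def)

lemma class_function_three_cycles:
  assumes f: "is_class_function f" and g: "g \<in> S4_three_cycles" and h: "h \<in> S4_three_cycles"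
  shows "f g = f h"
proof -
  obtain k where k: "k \<in> carrier S4" "one_line k = [2, 3, 1, 4]"
    by (rule one_line_obtain[of "[2, 3, 1, 4]"]) (simp add: perm_lists_def set_n_lists)
  have "f u = f k" if u: "u \<in> S4_three_cycles" for u
  proof (rule class_function_conj[OF f])
    show "u \<in> carrier S4" using u by (simp add: three_cycles_iff)
    then show "\<exists>l\<in>set perm_lists. list_comp l (one_line u) = list_comp (one_line k) l"
      using three_cycle_lists one_line_in u k(2) by (simp add: three_cycles_iff)
  qed (rule k(1))
  then show ?thesis using g h by simp
qed

lemma class_function_odd:
  assumes f: "is_class_function f" and g: "g \<in> odd_perms" and h: "h \<in> odd_perms"
    and klein: "\<And>u v. u \<in> carrier S4 \<Longrightarrow> v \<in> klein \<Longrightarrow> f (u \<circ> v) = f u"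
  shows "f g = f h"
proof -
  obtain k where k: "k \<in> carrier S4" "one_line k = [2, 1, 3, 4]"
    by (rule one_line_obtain[of "[2, 1, 3, 4]"]) (simp add: perm_lists_def set_n_lists)
  have "f u = f k" if u: "u \<in> odd_perms" for u
  proof -
    have uG: "u \<in> carrier S4" using u by (simp add: odd_perms_def)
    have "odd_list (one_line u)" using u by (simp add: odd_perms_def)
    then obtain m where m: "m \<in> set klein_lists"
        "\<exists>l\<in>set perm_lists. list_comp l (one_line u) = list_comp (list_comp (one_line k) m) l"
      using odd_lists_conj one_line_in[OF uG] unfolding k(2) by blast
    obtain v where v: "v \<in> carrier S4" "one_line v = m"
      using one_line_obtain m(1) klein_lists_subset by blast
    have "f u = f (k \<circ> v)"
      using m k(1) v by (intro class_function_conj[OF f uG]) (auto simp: one_line_comp)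
    also have "\<dots> = f k"
      using v m(1) k(1) by (intro klein) (auto simp: klein_def)
    finally show ?thesis .
  qed
  then show ?thesis using g h by simp
qed

lemma three_cycle_cube:
  assumes "g \<in> S4_three_cycles"
  shows "g \<circ> g \<circ> g = id" "g \<circ> g \<in> S4_three_cycles"
proof -
  have g: "g \<in> carrier S4" using assms by (simp add: three_cycles_iff)
  have "one_line (g \<circ> g \<circ> g) = one_line id"
    using three_cycle_lists one_line_in[OF g] assms g by (simp add: three_cycles_iff one_line_comp)
  then show "g \<circ> g \<circ> g = id"
    using g by (subst (asm) one_line_eq_iff) auto
  show "g \<circ> g \<in> S4_three_cycles"
    using three_cycle_lists one_line_in[OF g] assms g by (auto simp: three_cycles_iff one_line_comp)
qed

lemma three_cycle_subgroup:
  assumes "g \<in> S4_three_cycles"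
  shows "subgroup {id, g, g \<circ> g} S4"
proof -
  note c = three_cycle_cube[OF assms]
  have g: "g \<in> carrier S4" using assms by (simp add: three_cycles_iff)
  have eqs: "g \<circ> (g \<circ> g) = id" "g \<circ> g \<circ> (g \<circ> g) = g"
    using c(1) by (metis comp_assoc, metis comp_assoc comp_id id_comp)
  have "inv\<^bsub>S4\<^esub> g = g \<circ> g"
    by (rule S4.inv_equality) (use g c(1) in simp_all)
  moreover have "inv\<^bsub>S4\<^esub> (g \<circ> g) = g"
    by (rule S4.inv_equality) (use g eqs in simp_all)
  moreover have "inv\<^bsub>S4\<^esub> id = id"
    by (rule S4.inv_equality) simp_all
  ultimately have "\<forall>x\<in>{id, g, g \<circ> g}. inv\<^bsub>S4\<^esub> x \<in> {id, g, g \<circ> g}"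
    by (simp only: ball_simps insert_iff simp_thms)
  then show ?thesis
    by (intro S4.subgroupI) (use g c(1) eqs in \<open>auto simp only: S4_simps S4_comp_closed S4_id insert_iff empty_iff comp_id id_comp\<close>)
qed

lemma card_preimage_one_line:
  "card {g \<in> carrier S4. P (one_line g)} = length (filter P perm_lists)"
proof -
  have "bij_betw one_line {g \<in> carrier S4. P (one_line g)} (set (filter P perm_lists))"
    using one_line_bij by (auto simp: bij_betw_def inj_on_def)
  then have "card {g \<in> carrier S4. P (one_line g)} = card (set (filter P perm_lists))"
    by (rule bij_betw_same_card)
  also have "\<dots> = length (filter P perm_lists)"
    by (intro distinct_card distinct_filter distinct_perm_lists)
  finally show ?thesis .
qed

lemma card_odd_perms: "card odd_perms = 12" and card_klein: "card klein = 4"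
  and card_three_cycles: "card S4_three_cycles = 8"
proof -
  show "card odd_perms = 12" "card klein = 4"
    using card_preimage_one_line[of "\<lambda>l. l \<in> set klein_lists"]
    by (simp_all only: odd_perms_def klein_def card_preimage_one_line card_lists)
  have "S4_three_cycles = {g \<in> carrier S4. \<not> odd_list (one_line g) \<and> one_line g \<notin> set klein_lists}"
    using three_cycles_iff by blast
  then show "card S4_three_cycles = 8"
    using card_preimage_one_line[of "\<lambda>l. \<not> odd_list l \<and> l \<notin> set klein_lists"] card_lists(3) by simp
qed

lemma finite_parts [simp]: "finite odd_perms" "finite klein" "finite S4_three_cycles"
  by (rule finite_subset[OF _ finite_S4], simp add: klein_subset odd_perms_subset three_cycles_subset)+

lemma sum_S4:
  fixes f :: "(nat \<Rightarrow> nat) \<Rightarrow> complex"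
  shows "sum f (carrier S4) = sum f klein + sum f S4_three_cycles + sum f odd_perms"
proof -
  have "carrier S4 = (klein \<union> S4_three_cycles) \<union> odd_perms"
    using klein_subset odd_perms_subset by (auto simp: S4_three_cycles_def)
  moreover have "(klein \<union> S4_three_cycles) \<inter> odd_perms = {}" "klein \<inter> S4_three_cycles = {}"
    using klein_not_odd by (auto simp: S4_three_cycles_def)
  ultimately show ?thesis by (simp add: sum.union_disjoint)
qed

lemma class_function_sum_klein:
  assumes "is_class_function f" "v \<in> klein - {id}"
  shows "sum f klein = f id + 3 * f v"
proof -
  have "sum f klein = f id + sum f (klein - {id})"
    by (rule sum.remove) simp_all
  also have "sum f (klein - {id}) = (\<Sum>w\<in>klein - {id}. f v)"
    using class_function_klein[OF assms(1) _ assms(2)] by (intro sum.cong refl)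
  also have "\<dots> = 3 * f v"
    by (simp add: card_klein)
  finally show ?thesis .
qed

section \<open>The irreducible character of degree two\<close>

lemma S4_cases:
  assumes "g \<in> carrier S4"
  obtains "g \<in> klein" | "g \<in> S4_three_cycles" | "g \<in> odd_perms"
  using assms by (auto simp: S4_three_cycles_def)

text \<open>
  The permutation character on the three nonidentity elements of the Klein four-group, minus the
  trivial character.
\<close>

definition standard_character :: "(nat \<Rightarrow> nat) \<Rightarrow> complex" where
  "standard_character g = (if g \<in> klein then 2 else if g \<in> S4_three_cycles then - 1 else 0)"

lemma standard_character_odd: "g \<in> odd_perms \<Longrightarrow> standard_character g = 0"
  using klein_not_odd[of g] by (auto simp: standard_character_def S4_three_cycles_def)

lemma klein_nontrivial: obtains v where "v \<in> klein - {id}"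
proof -
  have "card klein \<noteq> card {id :: nat \<Rightarrow> nat}"
    using card_klein by simp
  then have "klein \<noteq> {id}" by metis
  then show thesis using that id_in_klein by blast
qed

lemma two_element_subgroup:
  assumes "g \<in> carrier S4" "g \<circ> g = id"
  shows "subgroup {id, g} S4"
proof -
  have "inv\<^bsub>S4\<^esub> g = g"
    by (rule S4.inv_equality) (use assms in simp_all)
  moreover have "inv\<^bsub>S4\<^esub> id = id"
    by (rule S4.inv_equality) simp_all
  ultimately have "\<forall>x\<in>{id, g}. inv\<^bsub>S4\<^esub> x \<in> {id, g}"
    by (simp only: ball_simps insert_iff simp_thms)
  then show ?thesis
    by (intro S4.subgroupI) (use assms in \<open>auto simp only: S4_simps S4_id insert_iff empty_iff comp_id id_comp\<close>)
qed

text \<open>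
  Let \<open>x\<close> be the value of the character at the nonidentity elements of the Klein four-group. A
  subgroup of order two shows that \<open>x\<close> is an even integer, so the sum \<open>2 + 3 * x\<close> over the
  four-group is not zero and the four-group acts trivially. The character then has one value on
  all odd permutations and one on all 3-cycles. Orthogonality to the trivial character and to the
  sign gives two linear equations, which determine both values.
\<close>

lemma irreducible_degree_2_character:
  assumes irr: "irreducible_rep S4 2 R"
  shows "rep_character S4 R = standard_character"
proof -
  have R: "mat_rep S4 2 R" using irr by (simp add: irreducible_rep_def)
  define \<chi> where "\<chi> g = mat_trace (R g)" for g
  have cf: "is_class_function \<chi>"
    unfolding is_class_function_def \<chi>_def
  proof (intro ballI impI)
    fix g h k assume "g \<in> carrier S4" "h \<in> carrier S4" "k \<in> carrier S4" "k \<circ> g = h \<circ> k"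
    then show "mat_trace (R g) = mat_trace (R h)"
      by (intro S4.mat_trace_conj[OF R, of g h k]) (simp_all only: S4_simps)
  qed
  have \<chi>_id: "\<chi> id = 2"
    using R by (simp add: \<chi>_def mat_rep_def)
  obtain v where v: "v \<in> klein - {id}" by (rule klein_nontrivial)
  have "subgroup {id, v} S4"
    using v klein_square by (intro two_element_subgroup) (auto simp: klein_def)
  from S4.sum_mat_trace_subgroup[OF R this]
  obtain m :: nat where "\<chi> id + \<chi> v = 2 * of_nat m"
    using v by (auto simp: \<chi>_def card_insert_if)
  then have \<chi>_v: "\<chi> v = 2 * of_nat m - 2"
    using \<chi>_id by (simp add: algebra_simps)
  have "sum \<chi> klein = of_int (6 * int m - 4)"
    unfolding class_function_sum_klein[OF cf v] \<chi>_id \<chi>_v by (simp add: algebra_simps)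
  moreover have "6 * int m - 4 \<noteq> 0" by presburger
  ultimately have "sum \<chi> klein \<noteq> 0"
    by (metis of_int_eq_0_iff)
  then have triv: "R w = 1\<^sub>m 2" if "w \<in> klein" for w
    using normal.irreducible_rep_trivial_on_normal[OF klein_normal irr _ _ that] by (simp add: \<chi>_def)
  have \<chi>_klein: "\<chi> w = 2" if "w \<in> klein" for w
    using triv[OF that] by (simp add: \<chi>_def)
  have "\<chi> (u \<circ> w) = \<chi> u" if "u \<in> carrier S4" "w \<in> klein" for u w
    using mat_rep_mult[OF R that(1)] mat_repD(1)[OF R that(1)] triv[OF that(2)] that klein_subset
    by (auto simp: \<chi>_def)
  note odd_const = class_function_odd[OF cf _ _ this]
  obtain t where t: "t \<in> odd_perms"
    using card_odd_perms by fastforce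
  obtain z where z: "z \<in> S4_three_cycles"
    using card_three_cycles by fastforce
  have sum_klein: "sum \<chi> klein = 8"
    using \<chi>_klein card_klein by simp
  have sum_three: "sum \<chi> S4_three_cycles = 8 * \<chi> z"
    using class_function_three_cycles[OF cf _ z] card_three_cycles by simp
  have sum_odd: "sum \<chi> odd_perms = 12 * \<chi> t"
    using odd_const[OF _ t] card_odd_perms by simp
  have plus: "8 + 8 * \<chi> z + 12 * \<chi> t = 0"
    using S4.sum_mat_trace_irreducible[OF irr] sum_S4[of \<chi>] sum_klein sum_three sum_odd
    by (simp add: \<chi>_def)
  \<comment> \<open>Orthogonality to the sign is orthogonality of the sign twist to the trivial character.\<close>
  define \<epsilon> :: "(nat \<Rightarrow> nat) \<Rightarrow> complex" where "\<epsilon> g = (if g \<in> odd_perms then - 1 else 1)" for g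
  have "irreducible_rep S4 2 (\<lambda>g. \<epsilon> g \<cdot>\<^sub>m R g)"
    by (rule irreducible_rep_twist[OF irr])
      (use klein_not_odd[OF id_in_klein] odd_perms_comp in \<open>auto simp: \<epsilon>_def\<close>)
  from S4.sum_mat_trace_irreducible[OF this]
  have "(\<Sum>g\<in>carrier S4. mat_trace (\<epsilon> g \<cdot>\<^sub>m R g)) = 0" by simp
  also have "(\<Sum>g\<in>carrier S4. mat_trace (\<epsilon> g \<cdot>\<^sub>m R g)) = (\<Sum>g\<in>carrier S4. \<epsilon> g * \<chi> g)"
    using mat_repD[OF R] by (intro sum.cong refl) (simp add: mat_trace_def \<chi>_def sum_distrib_left)
  also have "\<dots> = sum \<chi> klein + sum \<chi> S4_three_cycles - sum \<chi> odd_perms"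
  proof -
    have "(\<Sum>g\<in>klein. \<epsilon> g * \<chi> g) = sum \<chi> klein"
      using klein_not_odd by (intro sum.cong) (auto simp: \<epsilon>_def)
    moreover have "(\<Sum>g\<in>S4_three_cycles. \<epsilon> g * \<chi> g) = sum \<chi> S4_three_cycles"
      by (intro sum.cong) (auto simp: \<epsilon>_def S4_three_cycles_def)
    moreover have "(\<Sum>g\<in>odd_perms. \<epsilon> g * \<chi> g) = - sum \<chi> odd_perms"
      by (simp add: \<epsilon>_def sum_negf)
    ultimately show ?thesis by (simp add: sum_S4)
  qed
  finally have minus: "8 + 8 * \<chi> z - 12 * \<chi> t = 0"
    by (simp add: sum_klein sum_three sum_odd)
  have "24 * \<chi> t = (8 + 8 * \<chi> z + 12 * \<chi> t) - (8 + 8 * \<chi> z - 12 * \<chi> t)"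
    by (simp add: algebra_simps)
  then have \<chi>_t: "\<chi> t = 0"
    unfolding plus minus by simp
  have "8 * (\<chi> z + 1) = 0"
    using plus \<chi>_t by (simp add: algebra_simps)
  then have \<chi>_z: "\<chi> z = - 1"
    by (metis mult_eq_0_iff zero_neq_numeral eq_neg_iff_add_eq_0)
  show ?thesis
  proof
    fix g
    show "rep_character S4 R g = standard_character g"
    proof (cases "g \<in> carrier S4")
      case True
      then have "\<chi> g = standard_character g"
      proof (cases rule: S4_cases)
        case 2
        then show ?thesis
          using class_function_three_cycles[OF cf 2 z] \<chi>_z
          by (simp add: standard_character_def S4_three_cycles_def)
      next
        case 3
        then show ?thesis
          using odd_const[OF 3 t] \<chi>_t klein_not_odd[of g]
          by (auto simp: standard_character_def S4_three_cycles_def)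
      qed (simp add: \<chi>_klein standard_character_def)
      then show ?thesis using True by (simp add: rep_character_def restrict_fun_def \<chi>_def)
    next
      case False
      then show ?thesis
        using klein_subset three_cycles_subset
        by (auto simp: rep_character_def restrict_fun_def standard_character_def)
    qed
  qed
qed

text \<open>
  Only irreducibility has to be checked on the explicit matrices; the character values then
  follow from the preceding classification.
\<close>

lemma standard_character_irreducible: "standard_character \<in> irreducible_characters S4"
proof -
  define p where "p g = klein_action_list (one_line g)" for g
  have le2: "i \<le> 2 \<longleftrightarrow> i \<in> {0, 1, 2}" for i :: nat by auto
  have R: "mat_rep S4 2 (standard_rep 2 p)"
  proof (rule standard_rep_mat_rep)
    show "p \<one>\<^bsub>S4\<^esub> i = i" if "i \<le> 2" for i
      using that klein_action_lists(2) unfolding le2 by (auto simp: p_def)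
    show "p g i \<le> 2" for g i
      by (simp add: p_def klein_action_list_def Let_def)
    show "p (g \<otimes>\<^bsub>S4\<^esub> h) i = p g (p h i)"
      if "g \<in> carrier S4" "h \<in> carrier S4" "i \<le> 2" for g h i
      using that(1,2) that(3)[unfolded le2] klein_action_lists(1) one_line_in
      by (simp only: p_def S4_simps one_line_comp)
  qed
  obtain g where g: "g \<in> carrier S4" "one_line g = [1, 3, 2, 4]"
    by (rule one_line_obtain[of "[1, 3, 2, 4]"]) (simp add: perm_lists_def set_n_lists)
  obtain h where h: "h \<in> carrier S4" "one_line h = [1, 4, 3, 2]"
    by (rule one_line_obtain[of "[1, 4, 3, 2]"]) (simp add: perm_lists_def set_n_lists)
  have "irreducible_rep S4 2 (standard_rep 2 p)"
    by (rule standard_rep_2_irreducible[OF R g(1) _ _ _ h(1)])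
      (use klein_action_lists(3,4) in \<open>simp_all add: p_def g(2) h(2)\<close>)
  then show ?thesis
    using irreducible_degree_2_character unfolding irreducible_characters_def
    by (intro CollectI exI[of _ 2] exI[of _ "standard_rep 2 p"]) simp
qed

lemma degree_2_irreducible_iff:
  "\<rho> \<in> irreducible_characters S4 \<and> char_degree S4 \<rho> = 2 \<longleftrightarrow> \<rho> = standard_character"
proof
  assume \<rho>: "\<rho> \<in> irreducible_characters S4 \<and> char_degree S4 \<rho> = 2"
  then obtain n R where R: "irreducible_rep S4 n R" "\<rho> = rep_character S4 R"
    by (auto simp: irreducible_characters_def)
  then have "n = 2"
    using \<rho> char_degree_rep_character[OF S4.is_group, of n R] by (simp add: irreducible_rep_def)
  then show "\<rho> = standard_character"
    using R irreducible_degree_2_character by simp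
qed (use standard_character_irreducible in \<open>simp add: char_degree_def standard_character_def\<close>)

text \<open>
  A virtual character below this one vanishes on odd permutations. Its degree \<open>d\<close> is congruent
  modulo 2 to its value at a transposition, which is zero, so \<open>d = 2\<close>. A further zero on the Klein
  four-group or on the 3-cycles would extend to all nonidentity elements of the four-group or of
  a subgroup of order three, and make \<open>2\<close> divisible by 4 or by 3.
\<close>

lemma standard_character_minimal: "minimal_vchar S4 standard_character"
  unfolding minimal_vchar_def
proof (intro conjI ballI impI)
  have deg: "char_degree S4 standard_character = 2"
    using degree_2_irreducible_iff by blast
  show "standard_character \<in> pos_virtual_characters S4"
    using deg irreducible_imp_virtual_character[OF standard_character_irreducible]
    by (simp add: pos_virtual_characters_def)
  fix \<phi> assume \<phi>: "\<phi> \<in> pos_virtual_characters S4" and le: "vchar_le S4 \<phi> standard_character"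
  define d where "d = char_degree S4 \<phi>"
  have virt: "\<phi> \<in> virtual_characters S4" and d: "0 < d" "d \<le> 2"
    using \<phi> le deg by (auto simp: pos_virtual_characters_def vchar_le_def d_def)
  have \<phi>_id: "\<phi> id = of_int d"
    using S4.virtual_character_one[OF virt] by (simp add: d_def)
  have cf: "is_class_function \<phi>"
    unfolding is_class_function_def
  proof (intro ballI impI)
    fix g h k assume "g \<in> carrier S4" "h \<in> carrier S4" "k \<in> carrier S4" "k \<circ> g = h \<circ> k"
    then show "\<phi> g = \<phi> h"
      by (intro S4.virtual_character_conj[OF virt, of g h k]) (simp_all only: S4_simps)
  qed
  have odd: "\<phi> g = 0" if "g \<in> odd_perms" for g
    using that le standard_character_odd[OF that] odd_perms_subset by (auto simp: vchar_le_def)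
  obtain t where t: "t \<in> carrier S4" "one_line t = [2, 1, 3, 4]"
    by (rule one_line_obtain[of "[2, 1, 3, 4]"]) (simp add: perm_lists_def set_n_lists)
  have "odd_list [2, 1, 3, 4]" by code_simp
  then have t_odd: "t \<in> odd_perms" using t by (simp add: odd_perms_def)
  then have "t \<noteq> id" using klein_not_odd id_in_klein by blast
  have "one_line (t \<circ> t) = one_line id"
    using t by (simp add: one_line_comp list_comp_def)
  then have "t \<circ> t = id"
    using t by (subst (asm) one_line_eq_iff) auto
  from S4.sum_virtual_character_subgroup[OF virt two_element_subgroup[OF t(1) this]]
  obtain m :: int where "complex_of_int d = of_int (2 * m)"
    using \<open>t \<noteq> id\<close> odd[OF t_odd] \<phi>_id by (auto simp: card_insert_if)
  then have "d = 2 * m" by (simp only: of_int_eq_iff)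
  with d have d2: "d = 2" by presburger
  have "\<phi> g \<noteq> 0" if g: "g \<in> carrier S4" "g \<notin> odd_perms" for g
  proof
    assume zero: "\<phi> g = 0"
    show False
      using g(1)
    proof (cases rule: S4_cases)
      case 1
      then have "g \<in> klein - {id}"
        using zero \<phi>_id d2 by auto
      then have "sum \<phi> klein = of_int 2"
        using class_function_sum_klein[OF cf] zero \<phi>_id d2 by simp
      moreover obtain m :: int where "sum \<phi> klein = of_int (4 * m)"
        using S4.sum_virtual_character_subgroup[OF virt klein_subgroup] card_klein by auto
      ultimately have "2 = 4 * m" by (metis of_int_eq_iff)
      then show False by presburger
    next
      case 2
      note c = three_cycle_cube[OF 2]
      have "\<phi> (g \<circ> g) = 0"
        using class_function_three_cycles[OF cf c(2) 2] zero by simp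
      moreover have "id \<notin> S4_three_cycles" by (simp add: S4_three_cycles_def)
      then have distinct: "id \<noteq> g" "id \<noteq> g \<circ> g" "g \<noteq> g \<circ> g"
        using 2 c by (auto simp: comp_assoc)
      ultimately have "(\<Sum>h\<in>{id, g, g \<circ> g}. \<phi> h) = of_int 2"
        using zero \<phi>_id d2 by simp
      moreover obtain m :: int where "(\<Sum>h\<in>{id, g, g \<circ> g}. \<phi> h) = of_int (3 * m)"
        using S4.sum_virtual_character_subgroup[OF virt three_cycle_subgroup[OF 2]] distinct by auto
      ultimately have "2 = 3 * m" by (metis of_int_eq_iff)
      then show False by presburger
    qed (use g in simp)
  qed
  then show "vchar_le S4 standard_character \<phi>"
    using deg d2 by (auto simp: vchar_le_def d_def standard_character_def klein_not_odd S4_three_cycles_def)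
qed

section \<open>Sylow 2-subgroups\<close>

lemma sylow_2_card:
  assumes "sylow_subgroup S4 2 S"
  shows "card S = 8"
proof -
  have "multiplicity 2 (2 ^ 3 * 3 :: nat) = 3"
    by (rule multiplicity_eqI) simp_all
  then show ?thesis
    using assms card_S4 by (simp add: sylow_subgroup_def Coset.order_def)
qed

text \<open>
  A group of order eight contains no 3-cycle, so its even elements lie in the Klein four-group.
  They number at most four, so there are odd elements; multiplication by one of these injects the
  odd elements into the even ones, so that the even elements fill the four-group.
\<close>

lemma sylow_2_odd_and_klein:
  assumes sub: "subgroup S S4" and card: "card S = 8"
  shows "S - odd_perms = klein" "S \<inter> odd_perms \<noteq> {}"
proof -
  have SG: "S \<subseteq> carrier S4" using sub by (rule subgroup.subset)
  have fin: "finite S" using card by (simp add: card_ge_0_finite)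
  have closed: "g \<circ> h \<in> S" if "g \<in> S" "h \<in> S" for g h
    using subgroup.m_closed[OF sub that] by simp
  have even: "S - odd_perms \<subseteq> klein"
  proof
    fix g assume g: "g \<in> S - odd_perms"
    have "g \<notin> S4_three_cycles"
    proof
      assume g3: "g \<in> S4_three_cycles"
      interpret S: group "S4\<lparr>carrier := S\<rparr>"
        by (rule S4.subgroup_imp_group[OF sub])
      have "g [^]\<^bsub>S4\<lparr>carrier := S\<rparr>\<^esub> (8 :: nat) = id"
        using S.pow_order_eq_1[of g] g card by (simp add: Coset.order_def)
      then have pow8: "g \<circ> g \<circ> g \<circ> (g \<circ> g \<circ> g) \<circ> (g \<circ> g) = id"
        by (simp add: nat_pow_def eval_nat_numeral comp_assoc)
      have "g \<circ> g = id"
        using pow8 three_cycle_cube(1)[OF g3] by simp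
      then show False
        using three_cycle_cube(2)[OF g3] by (simp add: S4_three_cycles_def)
    qed
    then show "g \<in> klein"
      using g SG by (auto simp: S4_three_cycles_def)
  qed
  have split: "card S = card (S - odd_perms) + card (S \<inter> odd_perms)"
    using card_Int_Diff[OF fin, of odd_perms] by simp
  have le4: "card (S - odd_perms) \<le> 4"
    using card_mono[OF _ even] card_klein by simp
  show ne: "S \<inter> odd_perms \<noteq> {}"
    using split le4 card by auto
  then obtain t where t: "t \<in> S" "t \<in> odd_perms" by blast
  have "card (S \<inter> odd_perms) \<le> card (S - odd_perms)"
  proof (rule card_inj_on_le[where f = "\<lambda>g. t \<circ> g"])
    show "inj_on (\<lambda>g. t \<circ> g) (S \<inter> odd_perms)"
      using t S4.inj_on_cmult[of t] SG by (auto simp: inj_on_def)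
    show "(\<lambda>g. t \<circ> g) ` (S \<inter> odd_perms) \<subseteq> S - odd_perms"
      using t closed odd_perms_comp SG by blast
  qed (use fin in simp)
  then have "card (S - odd_perms) = 4"
    using split le4 card by linarith
  then show "S - odd_perms = klein"
    using even by (intro card_subset_eq) (simp_all add: card_klein)
qed

lemma odd_perm_dihedral:
  assumes g: "g \<in> odd_perms"
  obtains v t where "v \<in> klein" "t \<in> klein"
    "g \<circ> v \<circ> (g \<circ> v) \<circ> (g \<circ> v \<circ> (g \<circ> v)) = id" "t \<circ> (g \<circ> v) \<circ> t \<circ> (g \<circ> v) = id"
    "distinct [id, g \<circ> v \<circ> (g \<circ> v), t, g \<circ> v \<circ> (g \<circ> v) \<circ> t]"
proof -
  have gG: "g \<in> carrier S4" and odd: "odd_list (one_line g)"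
    using g by (auto simp: odd_perms_def)
  obtain lv lt where l: "lv \<in> set klein_lists" "lt \<in> set klein_lists"
    "let r = list_comp (one_line g) lv; r2 = list_comp r r
     in list_comp r2 r2 = [1, 2, 3, 4] \<and> list_comp (list_comp (list_comp lt r) lt) r = [1, 2, 3, 4] \<and>
        distinct [[1, 2, 3, 4], r2, lt, list_comp r2 lt]"
    using odd_lists_dihedral one_line_in[OF gG] odd by blast
  obtain v where v: "v \<in> carrier S4" "one_line v = lv"
    using one_line_obtain l(1) klein_lists_subset by blast
  obtain t where t: "t \<in> carrier S4" "one_line t = lt"
    using one_line_obtain l(2) klein_lists_subset by blast
  have vt: "v \<in> klein" "t \<in> klein"
    using v t l(1,2) by (simp_all add: klein_def)
  define r where "r = g \<circ> v"
  have r: "r \<in> carrier S4" "one_line r = list_comp (one_line g) lv"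
    using gG v by (simp_all add: r_def one_line_comp)
  have "one_line (r \<circ> r \<circ> (r \<circ> r)) = one_line id" "one_line (t \<circ> r \<circ> t \<circ> r) = one_line id"
    using l(3) r t by (simp_all add: Let_def one_line_comp)
  then have 1: "r \<circ> r \<circ> (r \<circ> r) = id" and 2: "t \<circ> r \<circ> t \<circ> r = id"
    using r(1) t(1) by (simp_all only: one_line_eq_iff S4_comp_closed S4_id)
  have "distinct (map one_line [id, r \<circ> r, t, r \<circ> r \<circ> t])"
    using l(3) r t by (simp add: Let_def one_line_comp)
  then have 3: "distinct [id, r \<circ> r, t, r \<circ> r \<circ> t]"
    by (simp only: distinct_map)
  show thesis
    by (rule that[OF vt 1[unfolded r_def] 2[unfolded r_def] 3[unfolded r_def]])
qed

text \<open>
  Besides the isomorphism, the matching of parities is recorded: it identifies the zeros of the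
  restricted character on the side of the dihedral group.
\<close>

lemma sylow_2_iso_dihedral:
  assumes sub: "subgroup S S4" and card: "card S = 8"
  obtains \<phi> where "\<phi> \<in> iso (S4\<lparr>carrier := S\<rparr>) (dihedral_group 4)"
    "\<forall>g\<in>S. even (fst (\<phi> g)) \<longleftrightarrow> g \<in> klein"
proof -
  let ?S = "S4\<lparr>carrier := S\<rparr>"
  interpret S: group ?S
    by (rule S4.subgroup_imp_group[OF sub])
  have SG: "S \<subseteq> carrier S4" using sub by (rule subgroup.subset)
  have fin: "finite S" using card by (simp add: card_ge_0_finite)
  have closed: "g \<circ> h \<in> S" if "g \<in> S" "h \<in> S" for g h
    using subgroup.m_closed[OF sub that] by simp
  note parts = sylow_2_odd_and_klein[OF sub card]
  obtain g where g: "g \<in> S" "g \<in> odd_perms" using parts(2) by blast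
  obtain v t where vt: "v \<in> klein" "t \<in> klein"
    and r4: "g \<circ> v \<circ> (g \<circ> v) \<circ> (g \<circ> v \<circ> (g \<circ> v)) = id"
    and conj: "t \<circ> (g \<circ> v) \<circ> t \<circ> (g \<circ> v) = id"
    and dist: "distinct [id, g \<circ> v \<circ> (g \<circ> v), t, g \<circ> v \<circ> (g \<circ> v) \<circ> t]"
    by (rule odd_perm_dihedral[OF g(2)])
  define r where "r = g \<circ> v"
  note r4 = r4[folded r_def] and conj = conj[folded r_def] and dist = dist[folded r_def]
  have vS: "v \<in> S" and tS: "t \<in> S" using vt parts(1) by auto
  then have rS: "r \<in> S" using closed g(1) by (simp add: r_def)
  have comp_odd: "x \<circ> y \<in> odd_perms \<longleftrightarrow> (x \<in> odd_perms) \<noteq> (y \<in> odd_perms)" if "x \<in> S" "y \<in> S" for x y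
    using that SG by (intro odd_perms_comp) auto
  have r_odd: "r \<in> odd_perms" and t_even: "t \<notin> odd_perms"
    using comp_odd[OF g(1) vS] g(2) klein_not_odd vt by (auto simp: r_def)
  define f where "f = (\<lambda>(i, s). r [^]\<^bsub>?S\<^esub> (i :: int) \<otimes>\<^bsub>?S\<^esub> (if s then t else \<one>\<^bsub>?S\<^esub>))"
  have f_hom: "f \<in> hom (dihedral_group 4) ?S"
    unfolding f_def
    by (rule S.dihedral_group_hom)
      (use rS tS r4 conj klein_square[OF vt(2)] in \<open>simp_all add: nat_pow_def eval_nat_numeral comp_assoc\<close>)
  have pows: "r [^]\<^bsub>?S\<^esub> (0 :: int) = id" "r [^]\<^bsub>?S\<^esub> (1 :: int) = r"
      "r [^]\<^bsub>?S\<^esub> (2 :: int) = r \<circ> r" "r [^]\<^bsub>?S\<^esub> (3 :: int) = r \<circ> r \<circ> r"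
    using rS by (simp_all add: int_pow_def2 nat_pow_def eval_nat_numeral)
  have f_odd: "f x \<in> odd_perms \<longleftrightarrow> odd (fst x)" if "x \<in> carrier (dihedral_group 4)" for x
    using that rS tS closed klein_not_odd[OF id_in_klein] r_odd t_even subgroup.one_closed[OF sub]
    by (cases rule: dihedral_8_cases) (auto simp: f_def pows comp_odd)
  have f_inj: "inj_on f (carrier (dihedral_group 4))"
  proof -
    let ?even = "[(0, False), (2, False), (0, True), (2, True)] :: (int \<times> bool) list"
    let ?odd = "[(1, False), (3, False), (1, True), (3, True)] :: (int \<times> bool) list"
    have "inj r" using rS SG by (auto simp: sym_group_carrier permutes_inj)
    then have inj_r: "inj_on (\<lambda>x. r \<circ> x) A" for A
      by (auto simp: inj_on_def fun_eq_iff)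
    have even: "map f ?even = [id, r \<circ> r, t, r \<circ> r \<circ> t]"
      by (simp add: f_def pows)
    have odd: "map f ?odd = map (\<lambda>x. r \<circ> x) [id, r \<circ> r, t, r \<circ> r \<circ> t]"
      by (simp add: f_def pows comp_assoc)
    have "distinct (map f ?even)"
      unfolding even by (rule dist)
    then have inj_even: "inj_on f (set ?even)"
      by (simp only: distinct_map)
    have "distinct (map f ?odd)"
      unfolding odd distinct_map using dist inj_r by blast
    then have inj_odd: "inj_on f (set ?odd)"
      by (simp only: distinct_map)
    show ?thesis
    proof (rule inj_onI)
      fix x y assume x: "x \<in> carrier (dihedral_group 4)" and y: "y \<in> carrier (dihedral_group 4)"
        and eq: "f x = f y"
      have par: "even (fst x) \<longleftrightarrow> even (fst y)"
        using f_odd[OF x] f_odd[OF y] eq by simp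
      have in_even: "z \<in> set ?even" if "z \<in> carrier (dihedral_group 4)" "even (fst z)" for z
        using that by (cases rule: dihedral_8_cases) auto
      have in_odd: "z \<in> set ?odd" if "z \<in> carrier (dihedral_group 4)" "odd (fst z)" for z
        using that by (cases rule: dihedral_8_cases) auto
      show "x = y"
        using inj_onD[OF inj_even eq in_even[OF x] in_even[OF y]]
          inj_onD[OF inj_odd eq in_odd[OF x] in_odd[OF y]] par by blast
    qed
  qed
  have "f ` carrier (dihedral_group 4) = S"
  proof (rule card_subset_eq[OF fin])
    show "f ` carrier (dihedral_group 4) \<subseteq> S"
      using f_hom by (auto simp: hom_def)
    show "card (f ` carrier (dihedral_group 4)) = card S"
      using card_image[OF f_inj] card by (simp add: card_cartesian_product)
  qed
  with f_inj have bij: "bij_betw f (carrier (dihedral_group 4)) S"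
    by (simp add: bij_betw_def)
  define \<phi> where "\<phi> = inv_into (carrier (dihedral_group 4)) f"
  have \<phi>_bij: "bij_betw \<phi> S (carrier (dihedral_group 4))"
    unfolding \<phi>_def by (rule bij_betw_inv_into[OF bij])
  have f\<phi>: "f (\<phi> x) = x" and \<phi>_in: "\<phi> x \<in> carrier (dihedral_group 4)" if "x \<in> S" for x
    using that bij_betw_inv_into_right[OF bij that] bij_betwE[OF \<phi>_bij] by (auto simp: \<phi>_def)
  have "\<phi> \<in> hom ?S (dihedral_group 4)"
  proof (rule homI)
    fix x y assume xy: "x \<in> carrier ?S" "y \<in> carrier ?S"
    have in_D: "\<phi> x \<otimes>\<^bsub>dihedral_group 4\<^esub> \<phi> y \<in> carrier (dihedral_group 4)"
      by (cases "\<phi> x"; cases "\<phi> y") simp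
    have "x \<otimes>\<^bsub>?S\<^esub> y = f (\<phi> x \<otimes>\<^bsub>dihedral_group 4\<^esub> \<phi> y)"
      using xy hom_mult[OF f_hom \<phi>_in \<phi>_in] f\<phi> by simp
    then show "\<phi> (x \<otimes>\<^bsub>?S\<^esub> y) = \<phi> x \<otimes>\<^bsub>dihedral_group 4\<^esub> \<phi> y"
      using bij_betw_inv_into_left[OF bij in_D] by (simp only: \<phi>_def)
  qed (use \<phi>_in in simp)
  then have iso: "\<phi> \<in> iso ?S (dihedral_group 4)"
    using \<phi>_bij by (simp add: iso_def)
  have "\<forall>x\<in>S. even (fst (\<phi> x)) \<longleftrightarrow> x \<in> klein"
    using f_odd[OF \<phi>_in] f\<phi> parts(1) by auto
  then show thesis by (rule that[OF iso])
qed

lemma savitskii_2_8: "savitskii_u 2 8 = 1" "savitskii_v 2 8 = 0"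
proof -
  show u: "savitskii_u 2 8 = 1"
    unfolding savitskii_u_def
  proof (rule Least_equality)
    show "0 < (1::int) \<and> (\<exists>v::int. 1 * 2 + v * 8 = gcd 2 8)"
      by (intro conjI exI[of _ 0]) (simp_all add: gcd_proj1_if_dvd)
  qed simp
  show "savitskii_v 2 8 = 0"
    unfolding savitskii_v_def u by (rule the_equality) (simp_all add: gcd_proj1_if_dvd)
qed

theorem mainTheorem10:
  fixes S :: "(nat \<Rightarrow> nat) set"
  assumes "sylow_subgroup (sym_group 4) 2 S"
  shows "sym_group 4\<lparr>carrier := S\<rparr> \<cong> dihedral_group 4 \<and>
    (\<exists>!\<rho>. \<rho> \<in> irreducible_characters (sym_group 4) \<and> char_degree (sym_group 4) \<rho> = 2) \<and>
    (\<forall>\<rho>. \<rho> \<in> irreducible_characters (sym_group 4) \<and> char_degree (sym_group 4) \<rho> = 2 \<longrightarrow>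
      minimal_vchar (sym_group 4) \<rho> \<and>
      (\<forall>u v :: int. 2 * u + 8 * v = 2 \<longrightarrow>
        virtual_combination (sym_group 4) S \<rho> u v
          \<in> pos_virtual_characters (sym_group 4\<lparr>carrier := S\<rparr>) \<and>
        \<not> minimal_vchar (sym_group 4\<lparr>carrier := S\<rparr>) (virtual_combination (sym_group 4) S \<rho> u v)) \<and>
      savitskii_restriction (sym_group 4) 2 S \<rho>
        \<in> pos_virtual_characters (sym_group 4\<lparr>carrier := S\<rparr>) \<and>
      \<not> minimal_vchar (sym_group 4\<lparr>carrier := S\<rparr>)
        (savitskii_restriction (sym_group 4) 2 S \<rho>))"
proof -
  have sub: "subgroup S S4" using assms by (simp add: sylow_subgroup_def)
  have card: "card S = 8" using assms by (rule sylow_2_card)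
  obtain \<phi> where \<phi>: "\<phi> \<in> iso (S4\<lparr>carrier := S\<rparr>) (dihedral_group 4)"
    and \<phi>_klein: "\<forall>g\<in>S. even (fst (\<phi> g)) \<longleftrightarrow> g \<in> klein"
    by (rule sylow_2_iso_dihedral[OF sub card])
  have on_S: "standard_character g = (if even (fst (\<phi> g)) then 2 else 0)" if "g \<in> S" for g
    using sylow_2_odd_and_klein(1)[OF sub card] that \<phi>_klein standard_character_odd[of g]
    by (auto simp: standard_character_def)
  have comb: "virtual_combination S4 S standard_character u v \<in> pos_virtual_characters (S4\<lparr>carrier := S\<rparr>)"
      "\<not> minimal_vchar (S4\<lparr>carrier := S\<rparr>) (virtual_combination S4 S standard_character u v)"
    if "2 * u + 8 * v = 2" for u v
  proof -
    have "virtual_combination S4 S standard_character u v =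
      (\<lambda>g. of_int u * restrict_fun (carrier (S4\<lparr>carrier := S\<rparr>)) (\<lambda>g. if even (fst (\<phi> g)) then 2 else 0) g +
        of_int v * regular_character (S4\<lparr>carrier := S\<rparr>) g)"
      by (rule ext) (simp add: virtual_combination_def restrict_fun_def on_S)
    from dihedral_8_virtual_combination[OF S4.subgroup_imp_group[OF sub] \<phi> that this]
    show "virtual_combination S4 S standard_character u v \<in> pos_virtual_characters (S4\<lparr>carrier := S\<rparr>)"
      "\<not> minimal_vchar (S4\<lparr>carrier := S\<rparr>) (virtual_combination S4 S standard_character u v)" .
  qed
  have "char_degree S4 standard_character = 2"
    using degree_2_irreducible_iff by blast
  moreover have "2 ^ multiplicity 2 (Coset.order S4) = (8 :: nat)"
    using assms card by (simp add: sylow_subgroup_def)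
  ultimately have sav: "savitskii_restriction S4 2 S standard_character =
      virtual_combination S4 S standard_character 1 0"
    by (simp add: savitskii_restriction_def savitskii_2_8)
  show ?thesis
    unfolding degree_2_irreducible_iff
    using is_isoI[OF \<phi>] standard_character_minimal comb comb[of 1 0] by (simp add: sav)
qed

end
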